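(* Let $1/q$ be a prime power, $\Bbbk:=\mathbb{F}_{1/q}$, $\lambda$ a partition of $n$ and $\alpha$ a weak composition of $n$. (i) For every semistandard tableau $T$ of shape $\lambda$ and content $\alpha$, $$\mathrm{wt}_q(T)=\frac{q^{\binom n2-n(\lambda)}(1-q)^{-n+\lambda_1}\prod_{i\ge1}[\lambda_i-\lambda_{i+1}]_q!}{\prod_{i\ge1}[\alpha_i]_q!}\,\big|\{N\in\mathfrak{n}_\alpha:\mathrm{JF}(N;E)=T\}\big|.$$ (ii) The coefficient of $\mathbf{x}^\alpha$ in $W_\lambda(\mathbf{x};q)$ equals $$\frac{q^{\binom n2-n(\lambda)}(1-q)^{-n+\lambda_1}\prod_{i\ge1}[\lambda_i-\lambda_{i+1}]_q!}{\prod_{i\ge1}[\alpha_i]_q!}\,\big|\{N\in\mathfrak{n}_\alpha:\mathrm{JF}(N)=\lambda\}\big|.$$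
   Context: For a weak composition $\alpha=(\alpha_1,\dots,\alpha_k)$ of $n$, its $i$th block is $I_i=\{\alpha_1+\cdots+\alpha_{i-1}+1,\dots,\alpha_1+\cdots+\alpha_i\}$; $\mathfrak{n}_\alpha\subseteq\mathfrak{gl}_n(\Bbbk)$ is the space of matrices whose entry $(r,s)$ is zero whenever $r\in I_i$, $s\in I_j$ with $j\le i$ (strictly block upper triangular). $E\in\mathrm{Fl}_\alpha$ is the flag with $E_i=\langle e_1,\dots,e_{\alpha_1+\cdots+\alpha_i}\rangle$; every $N\in\mathfrak{n}_\alpha$ is strictly compatible with $E$. $n(\lambda)=\sum_i\binom{\lambda_i}{2}$. For a nilpotent $N$, $\mathrm{JF}(N)$ is the partition with $\lambda_1+\cdots+\lambda_i=\dim\ker N^i$. $\mathrm{Fl}_\alpha$, strict compatibility ($N(F_i)\subseteq F_{i-1}$), $\mathrm{JF}(N;F)$ (the semistandard tableau whose entries $\le i$ form the shape $\mathrm{JF}(N|_{F_i})$), $[m]_q!$, $\binom{m}{r}_q$, $\mathrm{wt}_q(T)=\prod_{i,j\ge1}\binom{T^{(j)}_i-T^{(j)}_{i+1}}{T^{(j)}_i-T^{(j-1)}_i}_q$ (with $T^{(j)}$ the shape of entries $\le j$) and $W_\lambda(\mathbf{x};q)=\sum_T\mathrm{wt}_q(T)\mathbf{x}^T$ are as usual: $[m]_q=1+\cdots+q^{m-1}$, $[m]_q!=\prod_{r\le m}[r]_q$, $\mathbf{x}^T=\prod_i x_i^{\#i\text{'s in }T}$, $\mathbf{x}^\alpha=\prod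 x_i^{\alpha_i}$. *)

theory Defs
  imports Complex_Main "HOL-Library.Function_Algebras" "HOL-Computational_Algebra.Primes"
begin

definition qint :: "real \<Rightarrow> nat \<Rightarrow> real" where
  "qint q m = (\<Sum>r<m. q ^ r)"

definition qfact :: "real \<Rightarrow> nat \<Rightarrow> real" where
  "qfact q m = (\<Prod>r\<in>{1..m}. qint q r)"

definition qbinom :: "real \<Rightarrow> nat \<Rightarrow> nat \<Rightarrow> real" where
  "qbinom q m r = (if r \<le> m then qfact q m / (qfact q r * qfact q (m - r)) else 0)"

text \<open>A partition lam is a function nat => nat; lam i is the (i+1)-st part (0-based rows).\<close>
definition is_partition :: "nat \<Rightarrow> (nat \<Rightarrow> nat) \<Rightarrow> bool" where
  "is_partition n lam \<longleftrightarrow> (\<forall>i. lam (Suc i) \<le> lam i) \<and> (\<Sum>i<n. lam i) = n \<and> (\<forall>i\<ge>n. lam i = 0)"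

definition npart :: "nat \<Rightarrow> (nat \<Rightarrow> nat) \<Rightarrow> nat" where
  "npart n lam = (\<Sum>i<n. lam i choose 2)"

text \<open>A weak composition alpha = (alpha_1,...,alpha_k) is a list; alpha_i = alpha ! (i-1).\<close>
definition is_weak_comp :: "nat \<Rightarrow> nat list \<Rightarrow> bool" where
  "is_weak_comp n \<alpha> \<longleftrightarrow> sum_list \<alpha> = n"

text \<open>Tableaux: T (r,c) is the entry in row r, column c (0-based), entries are positive
  integers on the cells of the shape and 0 outside.\<close>
definition is_ssyt :: "(nat \<Rightarrow> nat) \<Rightarrow> nat list \<Rightarrow> (nat \<times> nat \<Rightarrow> nat) \<Rightarrow> bool" where
  "is_ssyt lam \<alpha> T \<longleftrightarrow>
     (\<forall>r c. T (r, c) \<noteq> 0 \<longleftrightarrow> c < lam r) \<and>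
     (\<forall>r c. Suc c < lam r \<longrightarrow> T (r, c) \<le> T (r, Suc c)) \<and>
     (\<forall>r c. c < lam (Suc r) \<longrightarrow> T (r, c) < T (Suc r, c)) \<and>
     (\<forall>v\<ge>1. card {x. T x = v} = (if v \<le> length \<alpha> then \<alpha> ! (v - 1) else 0))"

definition tshape :: "(nat \<times> nat \<Rightarrow> nat) \<Rightarrow> nat \<Rightarrow> nat \<Rightarrow> nat" where
  "tshape T j r = card {c. 1 \<le> T (r, c) \<and> T (r, c) \<le> j}"

text \<open>wt_q(T): the product over all i,j \<ge> 1; all factors with j > max entry or with row index
  beyond the number of cells equal 1, so the product is taken over these finite ranges.\<close>
definition wt :: "real \<Rightarrow> (nat \<times> nat \<Rightarrow> nat) \<Rightarrow> real" where
  "wt q T = (\<Prod>j\<in>{1..Max (range T)}. \<Prod>i\<in>{0..<card {x. T x \<noteq> 0}}.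
      qbinom q (tshape T j i - tshape T j (Suc i)) (tshape T j i - tshape T (j - 1) i))"

definition W_coeff :: "real \<Rightarrow> (nat \<Rightarrow> nat) \<Rightarrow> nat list \<Rightarrow> real" where
  "W_coeff q lam \<alpha> = (\<Sum>T\<in>{T. is_ssyt lam \<alpha> T}. wt q T)"

definition fscale :: "'k::field \<Rightarrow> (nat \<Rightarrow> 'k) \<Rightarrow> (nat \<Rightarrow> 'k)" where
  "fscale c v = (\<lambda>i. c * v i)"

definition vdim :: "(nat \<Rightarrow> 'k::field) set \<Rightarrow> nat" where
  "vdim S = vector_space.dim fscale S"

definition vecs :: "nat \<Rightarrow> (nat \<Rightarrow> 'k::field) set" where
  "vecs n = {v. \<forall>i\<ge>n. v i = 0}"

definition mats :: "nat \<Rightarrow> (nat \<Rightarrow> nat \<Rightarrow> 'k::field) set" where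
  "mats n = {N. \<forall>r s. (n \<le> r \<or> n \<le> s) \<longrightarrow> N r s = 0}"

definition mapply :: "nat \<Rightarrow> (nat \<Rightarrow> nat \<Rightarrow> 'k::field) \<Rightarrow> (nat \<Rightarrow> 'k) \<Rightarrow> (nat \<Rightarrow> 'k)" where
  "mapply n N v = (\<lambda>r. if r < n then (\<Sum>s<n. N r s * v s) else 0)"

text \<open>Jordan form of N restricted to an N-stable subspace F (0-based parts):
  lambda_1 + ... + lambda_i = dim ker (N|_F)^i.\<close>
definition JF_on :: "nat \<Rightarrow> (nat \<Rightarrow> nat \<Rightarrow> 'k::field) \<Rightarrow> (nat \<Rightarrow> 'k) set \<Rightarrow> nat \<Rightarrow> nat" where
  "JF_on n N F i = vdim {v\<in>F. (mapply n N ^^ Suc i) v = 0} - vdim {v\<in>F. (mapply n N ^^ i) v = 0}"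

definition JF :: "nat \<Rightarrow> (nat \<Rightarrow> nat \<Rightarrow> 'k::field) \<Rightarrow> nat \<Rightarrow> nat" where
  "JF n N = JF_on n N (vecs n)"

definition psum :: "nat list \<Rightarrow> nat \<Rightarrow> nat" where
  "psum \<alpha> i = sum_list (take i \<alpha>)"

definition Eflag :: "nat \<Rightarrow> nat list \<Rightarrow> nat \<Rightarrow> (nat \<Rightarrow> 'k::field) set" where
  "Eflag n \<alpha> i = {v\<in>vecs n. \<forall>r\<ge>psum \<alpha> i. v r = 0}"

text \<open>Block index (1-based) of the 0-based coordinate r: r \<in> I_i.\<close>
definition blk :: "nat list \<Rightarrow> nat \<Rightarrow> nat" where
  "blk \<alpha> r = (LEAST i. r < psum \<alpha> i)"

definition nalpha :: "nat \<Rightarrow> nat list \<Rightarrow> (nat \<Rightarrow> nat \<Rightarrow> 'k::field) set" where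
  "nalpha n \<alpha> = {N\<in>mats n. \<forall>r<n. \<forall>s<n. blk \<alpha> s \<le> blk \<alpha> r \<longrightarrow> N r s = 0}"

text \<open>JF(N;E): the tableau whose entries \<le> i form the shape JF(N|_{E_i}); the entry of
  cell (r,c) is the least i with c < JF(N|_{E_i})_r.\<close>
definition JF_flag :: "nat \<Rightarrow> nat list \<Rightarrow> (nat \<Rightarrow> nat \<Rightarrow> 'k::field) \<Rightarrow> (nat \<times> nat \<Rightarrow> nat)" where
  "JF_flag n \<alpha> N = (\<lambda>(r, c). if c < JF_on n N (Eflag n \<alpha> (length \<alpha>)) r
       then (LEAST i. c < JF_on n N (Eflag n \<alpha> i) r) else 0)"

end

theory Submission
  imports Defs "HOL-Library.Cardinality"
begin

text \<open>Build the matrix column by column. Let E be the coordinate subspace of dimension m spanned by the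
  completed blocks, let N act on V = k^(m+b) with N V contained in E, with shapes \<mu> on E and
  \<mu> + x on V, and append a column w in E. The shape of the extended matrix gains one box, in the
  first row t for which w lies in H(t) = N V + (E \<inter> ker N^t). Since
  |H(t)| = Q^(m+b) q^(\<mu>(t) + x(0) + ... + x(t)) with Q = |k| = 1/q, the number of ways to complete a
  block with a prescribed horizontal strip x satisfies a recurrence, which the identity
  [x(0)] + q^x(0) [x(1)] + q^(x(0)+x(1)) [x(2)] + ... = [x(0) + x(1) + ...] solves in closed form.
  The closed forms of the successive blocks telescope to the weight of the tableau. Part (ii) is the sum
  of part (i) over all tableaux, since JF(N;E) is semistandard for every N.\<close>

section \<open>Subspaces of a finite vector space and Jordan forms\<close>

text \<open>A kernel of a power of the extended matrix grows by one dimension exactly when it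
  contains a vector with last coordinate 1, that is, when N^t w lies in N^(t+1) V; this is where
  H(t) comes from. The columns w with box in row t number |H(t)| - |H(t-1)|. In row 0 nothing is
  subtracted, so its boxes bring no factor 1 - q^d, which is why the exponent of 1 - q in the
  theorem is -n + lambda_1 and not -n. The obstacle is that the flag does not record the shapes
  passed inside a block, so all orders in which the boxes of x can arrive must be summed. This is
  feasible because |H(t)| involves only the shape on E, which stays \<open>\<mu>\<close> during the
  whole block, and the current part of the strip: the recursion runs over x alone. The shares [x(t)]
  q^(x(0)+...+x(t-1)) / [b] of the possible last boxes then add up to 1, where b is the size of x.
  What telescopes is a function of the shape alone, \<open>normalizer\<close>: at \<open>lam\<close>
  it is the reciprocal of the constant in the theorem, without the factorials of the
  content.\<close>

declare plus_fun_apply [simp del] zero_fun_apply [simp del]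
  fun_diff_def [simp del] minus_apply [simp del] uminus_apply [simp del]

lemmas pointwise = fun_eq_iff plus_fun_apply zero_fun_apply minus_apply uminus_apply

interpretation vs: vector_space "fscale :: 'k::field \<Rightarrow> (nat \<Rightarrow> 'k) \<Rightarrow> nat \<Rightarrow> 'k"
  by unfold_locales (auto simp: fscale_def algebra_simps pointwise)

text \<open>The nonempty fibres of \<open>f\<close> are translates of its kernel. This plays the
  part of rank-nullity: dimensions are compared through cardinalities throughout.\<close>

lemma card_eq_card_kernel_times_card_image:
  fixes f :: "'a::ab_group_add \<Rightarrow> 'b::ab_group_add"
  assumes "finite S" and add: "\<And>x y. x \<in> S \<Longrightarrow> y \<in> S \<Longrightarrow> x + y \<in> S"
    and diff: "\<And>x y. x \<in> S \<Longrightarrow> y \<in> S \<Longrightarrow> x - y \<in> S"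
    and hom: "\<And>x y. x \<in> S \<Longrightarrow> y \<in> S \<Longrightarrow> f (x + y) = f x + f y"
  shows "card S = card {x \<in> S. f x = 0} * card (f ` S)"
proof -
  have hom_diff: "f (x - y) = f x - f y" if "x \<in> S" "y \<in> S" for x y
    using hom[OF diff[OF that] that(2)] by simp
  have fibre: "card {x \<in> S. f x = f z} = card {x \<in> S. f x = 0}" if z: "z \<in> S" for z
  proof -
    have "bij_betw (\<lambda>x. x - z) {x \<in> S. f x = f z} {x \<in> S. f x = 0}"
      by (rule bij_betw_byWitness[where f' = "\<lambda>x. x + z"]) (auto simp: add diff hom hom_diff z)
    then show ?thesis by (rule bij_betw_same_card)
  qed
  have "card S = (\<Sum>y\<in>f ` S. card {x \<in> S. f x = y})"
    using sum.image_gen[OF \<open>finite S\<close>, of "\<lambda>_. 1 :: nat" f] by simp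
  also have "\<dots> = (\<Sum>y\<in>f ` S. card {x \<in> S. f x = 0})"
    by (intro sum.cong) (auto simp: fibre)
  finally show ?thesis by simp
qed

lemma card_span_independent:
  fixes B :: "(nat \<Rightarrow> 'k::{field,finite}) set"
  assumes "finite B" "vs.independent B"
  shows "finite (vs.span B) \<and> card (vs.span B) = CARD('k) ^ card B"
  using assms
proof (induction B rule: finite_induct)
  case empty
  then show ?case by simp
next
  case (insert b B)
  then have IH: "finite (vs.span B)" "card (vs.span B) = CARD('k) ^ card B"
    and b: "b \<notin> vs.span B"
    by (auto simp: vs.independent_insert vs.dependent_mono)
  let ?g = "\<lambda>(c, v). fscale c b + v"
  have inj: "inj_on ?g (UNIV \<times> vs.span B)"
  proof (rule inj_onI, clarify)
    fix c v d w
    assume v: "v \<in> vs.span B" and w: "w \<in> vs.span B"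
      and eq: "fscale c b + v = fscale d b + w"
    have "fscale (c - d) b = w - v"
      using eq by (simp add: vs.scale_left_diff_distrib algebra_simps)
    then have "fscale (c - d) b \<in> vs.span B"
      using vs.span_diff[OF w v] by simp
    then have "fscale (1 / (c - d)) (fscale (c - d) b) \<in> vs.span B"
      by (rule vs.span_scale)
    then have "c = d" using b by (auto split: if_splits)
    then show "c = d \<and> v = w" using eq by simp
  qed
  have im: "?g ` (UNIV \<times> vs.span B) = vs.span (insert b B)"
    unfolding vs.span_insert
  proof (intro equalityI subsetI)
    fix x assume "x \<in> {x. \<exists>k. x - fscale k b \<in> vs.span B}"
    then obtain k where "x - fscale k b \<in> vs.span B" by blast
    then show "x \<in> ?g ` (UNIV \<times> vs.span B)"
      by (intro image_eqI[of _ _ "(k, x - fscale k b)"]) simp_all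
  next
    fix x assume "x \<in> ?g ` (UNIV \<times> vs.span B)"
    then obtain k v where "x = fscale k b + v" "v \<in> vs.span B" by auto
    then have "x - fscale k b \<in> vs.span B" by simp
    then show "x \<in> {x. \<exists>k. x - fscale k b \<in> vs.span B}" by blast
  qed
  have "finite (UNIV \<times> vs.span B :: ('k \<times> _) set)" using IH by simp
  then have "finite (vs.span (insert b B))" unfolding im[symmetric] by simp
  moreover have "card (vs.span (insert b B)) = card (UNIV \<times> vs.span B :: ('k \<times> _) set)"
    unfolding im[symmetric] by (rule card_image[OF inj])
  ultimately show ?case using insert.hyps IH by (simp add: card_cartesian_product)
qed

lemma card_subspace:
  fixes S :: "(nat \<Rightarrow> 'k::{field,finite}) set"
  assumes "vs.subspace S" "finite S"
  shows "card S = CARD('k) ^ vdim S"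
proof -
  obtain B where B: "B \<subseteq> S" "vs.independent B" "S \<subseteq> vs.span B" "card B = vs.dim S"
    using vs.basis_exists[of S] by metis
  have "vs.span B = S" using B assms(1) by (metis vs.span_minimal subset_antisym)
  moreover have "finite B" using B(1) assms(2) finite_subset by blast
  ultimately show ?thesis using card_span_independent[of B] B by (simp add: vdim_def)
qed

lemma CARD_field_gt_1: "CARD('k::{field,finite}) > 1"
  using card_mono[of "UNIV :: 'k set" "{0, 1}"] by simp

lemma subspace_vecs: "vs.subspace (vecs n)"
  by (auto simp: vs.subspace_def vecs_def fscale_def plus_fun_apply zero_fun_apply)

lemma vecs_mono: "m \<le> n \<Longrightarrow> vecs m \<subseteq> vecs n"
  by (auto simp: vecs_def)

lemma finite_vecs: "finite (vecs n :: (nat \<Rightarrow> 'k::{field,finite}) set)"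
  using finite_set_of_finite_funs[of "{..<n}" "UNIV :: 'k set" 0]
  by (rule finite_subset[rotated]) (auto simp: vecs_def)

lemma card_vecs: "card (vecs n :: (nat \<Rightarrow> 'k::{field,finite}) set) = CARD('k) ^ n"
proof (induction n)
  case 0
  have "vecs 0 = {0 :: nat \<Rightarrow> 'k}" by (auto simp: vecs_def pointwise)
  then show ?case by simp
next
  case (Suc n)
  let ?V = "vecs (Suc n) :: (nat \<Rightarrow> 'k) set"
  have "card ?V = card {v \<in> ?V. v n = 0} * card ((\<lambda>v. v n) ` ?V)"
    by (rule card_eq_card_kernel_times_card_image) (auto simp: finite_vecs, auto simp: vecs_def pointwise)
  also have "{v \<in> ?V. v n = 0} = vecs n"
    by (auto simp: vecs_def) (metis le_antisym not_less_eq_eq)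
  also have "(\<lambda>v. v n) ` ?V = UNIV"
  proof -
    have "c \<in> (\<lambda>v. v n) ` ?V" for c
      by (rule image_eqI[of _ _ "(\<lambda>_. 0)(n := c)"]) (auto simp: vecs_def)
    then show ?thesis by blast
  qed
  finally show ?case using Suc by simp
qed

lemma vdim_eqI:
  fixes S :: "(nat \<Rightarrow> 'k::{field,finite}) set"
  assumes "vs.subspace S" "finite S" "card S = CARD('k) ^ d"
  shows "vdim S = d"
  using card_subspace[OF assms(1,2)] assms(3) CARD_field_gt_1[where 'k = 'k] by simp

lemma vdim_vecs: "vdim (vecs n :: (nat \<Rightarrow> 'k::{field,finite}) set) = n"
  by (rule vdim_eqI) (simp_all add: subspace_vecs finite_vecs card_vecs)

lemma mapply_add: "mapply n N (u + v) = mapply n N u + mapply n N v"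
  by (auto simp: mapply_def pointwise algebra_simps sum.distrib)

lemma mapply_fscale: "mapply n N (fscale c v) = fscale c (mapply n N v)"
  by (auto simp: mapply_def pointwise fscale_def algebra_simps sum_distrib_left)

lemma mapply_pow_add: "(mapply n N ^^ i) (u + v) = (mapply n N ^^ i) u + (mapply n N ^^ i) v"
  by (induction i) (simp_all add: mapply_add)

lemma mapply_pow_fscale: "(mapply n N ^^ i) (fscale c v) = fscale c ((mapply n N ^^ i) v)"
  by (induction i) (simp_all add: mapply_fscale)

lemma mapply_pow_zero: "(mapply n N ^^ i) 0 = 0"
  using mapply_pow_fscale[where c = 0 and v = 0] by simp

lemma mapply_zero [simp]: "mapply n N 0 = 0"
  using mapply_pow_zero[where i = 1] by simp

lemma mapply_in_vecs: "mapply n N v \<in> vecs n"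
  by (auto simp: mapply_def vecs_def)

lemma mapply_pow_in_vecs: "v \<in> vecs n \<Longrightarrow> (mapply n N ^^ i) v \<in> vecs n"
  by (cases i) (simp_all add: mapply_in_vecs)

lemma subspace_kernel:
  assumes "vs.subspace F"
  shows "vs.subspace {v \<in> F. (mapply n N ^^ i) v = 0}"
  using assms
  by (auto simp: vs.subspace_def mapply_pow_add mapply_pow_fscale mapply_pow_zero)

lemma mapply_pow_kernel_mono:
  assumes "(mapply n N ^^ i) v = 0" "i \<le> j"
  shows "(mapply n N ^^ j) v = 0"
proof -
  obtain k where "j = k + i" using assms(2) le_iff_add by (metis add.commute)
  then show ?thesis using assms(1) by (simp add: funpow_add mapply_pow_zero)
qed

lemma vdim_mono:
  fixes S T :: "(nat \<Rightarrow> 'k::{field,finite}) set"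
  assumes "vs.subspace S" "vs.subspace T" "finite T" "S \<subseteq> T"
  shows "vdim S \<le> vdim T"
proof -
  have "CARD('k) ^ vdim S \<le> CARD('k) ^ vdim T"
    using card_mono[OF assms(3,4)] card_subspace assms finite_subset by metis
  then show ?thesis using CARD_field_gt_1[where 'k = 'k] by simp
qed

text \<open>Kernels of powers increase, so the natural subtraction in \<open>JF_on\<close> is exact
  and the sum telescopes.\<close>

lemma sum_JF_on:
  fixes N :: "nat \<Rightarrow> nat \<Rightarrow> 'k::{field,finite}"
  assumes "vs.subspace F" "finite F"
  shows "(\<Sum>i<t. JF_on n N F i) = vdim {v \<in> F. (mapply n N ^^ t) v = 0}"
proof (induction t)
  case 0
  have "{v \<in> F. (mapply n N ^^ 0) v = 0} = {0}"
    using assms by (auto simp: vs.subspace_def)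
  moreover have "vdim {0 :: nat \<Rightarrow> 'k} = 0"
    by (rule vdim_eqI) auto
  ultimately show ?case by simp
next
  case (Suc t)
  have "vdim {v \<in> F. (mapply n N ^^ t) v = 0} \<le> vdim {v \<in> F. (mapply n N ^^ Suc t) v = 0}"
    using assms by (intro vdim_mono subspace_kernel)
      (auto intro: mapply_pow_kernel_mono)
  then show ?case using Suc by (simp add: JF_on_def)
qed

lemma card_kernel:
  fixes N :: "nat \<Rightarrow> nat \<Rightarrow> 'k::{field,finite}"
  assumes "vs.subspace F" "finite F"
  shows "card {v \<in> F. (mapply n N ^^ t) v = 0} = CARD('k) ^ (\<Sum>i<t. JF_on n N F i)"
  unfolding sum_JF_on[OF assms] by (rule card_subspace) (use assms in \<open>auto intro: subspace_kernel\<close>)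

text \<open>\<open>N^i\<close> maps the kernel of \<open>N^(i+1)\<close> in \<open>F\<close> onto
  the right-hand set, with the kernel of \<open>N^i\<close> as its own kernel. In this form a row
  visibly depends only on the image of \<open>F\<close> under \<open>N^i\<close>, so rows can be
  compared by inclusion of images.\<close>

lemma card_JF_on:
  fixes N :: "nat \<Rightarrow> nat \<Rightarrow> 'k::{field,finite}"
  assumes "vs.subspace F" "finite F"
  shows "CARD('k) ^ JF_on n N F i = card {u \<in> (mapply n N ^^ i) ` F. mapply n N u = 0}"
proof -
  let ?K = "\<lambda>t. {v \<in> F. (mapply n N ^^ t) v = 0}"
  have sub: "vs.subspace (?K (Suc i))" by (rule subspace_kernel[OF assms(1)])
  have "card (?K (Suc i)) = card {v \<in> ?K (Suc i). (mapply n N ^^ i) v = 0}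
      * card ((mapply n N ^^ i) ` ?K (Suc i))"
    using assms(2) vs.subspace_add[OF sub] vs.subspace_diff[OF sub]
    by (intro card_eq_card_kernel_times_card_image) (auto simp: mapply_pow_add)
  also have "{v \<in> ?K (Suc i). (mapply n N ^^ i) v = 0} = ?K i"
    using mapply_pow_kernel_mono[where i = i and j = "Suc i"] by auto
  also have "(mapply n N ^^ i) ` ?K (Suc i) = {u \<in> (mapply n N ^^ i) ` F. mapply n N u = 0}"
    by auto
  finally show ?thesis
    using CARD_field_gt_1[where 'k = 'k] unfolding card_kernel[OF assms]
    by (simp add: power_add)
qed

lemma JF_on_le:
  fixes N :: "nat \<Rightarrow> nat \<Rightarrow> 'k::{field,finite}"
  assumes "vs.subspace F" "finite F" "vs.subspace G" "finite G"
    and "(mapply n N ^^ i) ` F \<subseteq> (mapply n N ^^ j) ` G"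
  shows "JF_on n N F i \<le> JF_on n N G j"
proof -
  have "CARD('k) ^ JF_on n N F i \<le> CARD('k) ^ JF_on n N G j"
    unfolding card_JF_on[OF assms(1,2)] card_JF_on[OF assms(3,4)]
    using assms(4,5) by (intro card_mono) auto
  then show ?thesis using CARD_field_gt_1[where 'k = 'k] by simp
qed

lemma JF_on_mono:
  fixes N :: "nat \<Rightarrow> nat \<Rightarrow> 'k::{field,finite}"
  assumes "vs.subspace F" "vs.subspace G" "finite G" "F \<subseteq> G"
  shows "JF_on n N F i \<le> JF_on n N G i"
  using assms finite_subset by (intro JF_on_le) blast+

text \<open>The image of \<open>F\<close> under \<open>N^(i+1)\<close> lies in the image of
  \<open>G\<close> under \<open>N^i\<close>. For consecutive flag members this is the horizontal
  strip condition.\<close>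

lemma JF_on_Suc_le:
  fixes N :: "nat \<Rightarrow> nat \<Rightarrow> 'k::{field,finite}"
  assumes "vs.subspace F" "finite F" "vs.subspace G" "finite G"
    and "mapply n N ` F \<subseteq> G"
  shows "JF_on n N F (Suc i) \<le> JF_on n N G i"
  using assms by (intro JF_on_le) (auto simp: funpow_Suc_right simp del: funpow.simps)

lemma sum_JF_on_nilpotent:
  fixes N :: "nat \<Rightarrow> nat \<Rightarrow> 'k::{field,finite}"
  assumes "vs.subspace F" "finite F" "\<And>v. v \<in> F \<Longrightarrow> (mapply n N ^^ t) v = 0"
  shows "(\<Sum>i<t. JF_on n N F i) = vdim F"
proof -
  have "{v \<in> F. (mapply n N ^^ t) v = 0} = F" using assms(3) by auto
  then show ?thesis using sum_JF_on[OF assms(1,2)] by simp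
qed

lemma JF_on_cong:
  assumes "\<And>v. v \<in> V \<Longrightarrow> mapply n N v = mapply n' N' v" "\<And>v. v \<in> V \<Longrightarrow> mapply n' N' v \<in> V" "F \<subseteq> V"
  shows "JF_on n N F = JF_on n' N' F"
proof -
  have "(mapply n N ^^ i) v = (mapply n' N' ^^ i) v \<and> (mapply n' N' ^^ i) v \<in> V" if "v \<in> V" for i v
    using that by (induction i) (auto simp: assms)
  then have "{v \<in> F. (mapply n N ^^ i) v = 0} = {v \<in> F. (mapply n' N' ^^ i) v = 0}" for i
    using assms(3) by auto
  then show ?thesis by (simp add: JF_on_def fun_eq_iff del: funpow.simps)
qed

section \<open>Adding one column\<close>

text \<open>Zero rows from \<open>m\<close> on encode strictness for the whole new block: the image
  stays in \<open>vecs m\<close>, so the \<open>b\<close> columns can be added one at a time, each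
  an arbitrary vector of \<open>vecs m\<close>.\<close>

definition colext :: "nat \<Rightarrow> nat \<Rightarrow> (nat \<Rightarrow> nat \<Rightarrow> 'k::field) \<Rightarrow> (nat \<Rightarrow> nat \<Rightarrow> 'k) set" where
  "colext m b M = {N \<in> mats (m + b). (\<forall>r s. s < m \<longrightarrow> N r s = M r s) \<and> (\<forall>r s. m \<le> r \<longrightarrow> N r s = 0)}"

definition addcol :: "nat \<Rightarrow> (nat \<Rightarrow> nat \<Rightarrow> 'k::field) \<Rightarrow> (nat \<Rightarrow> 'k) \<Rightarrow> nat \<Rightarrow> nat \<Rightarrow> 'k" where
  "addcol n N w = (\<lambda>r s. if s = n then w r else N r s)"

text \<open>The subspace H(t) = N V + (E \<inter> ker N^t) of E = vecs m, where V = vecs n, provided N V is contained in E.\<close>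
definition reach :: "nat \<Rightarrow> nat \<Rightarrow> (nat \<Rightarrow> nat \<Rightarrow> 'k::field) \<Rightarrow> nat \<Rightarrow> (nat \<Rightarrow> 'k) set" where
  "reach n m N t = {w \<in> vecs m. (mapply n N ^^ t) w \<in> (mapply n N ^^ Suc t) ` vecs n}"

lemma mapply_addcol:
  assumes "w \<in> vecs n" "N \<in> mats n"
  shows "mapply (Suc n) (addcol n N w) v = mapply n N v + fscale (v n) w"
proof
  fix r
  show "mapply (Suc n) (addcol n N w) v r = (mapply n N v + fscale (v n) w) r"
    using assms
    by (auto simp: mapply_def addcol_def fscale_def pointwise vecs_def mats_def mult.commute)
qed

lemma mapply_fun_upd: "mapply n N (v(n := c)) = mapply n N v"
  by (auto simp: mapply_def fun_eq_iff intro!: sum.cong)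

lemma vecs_upd_zero: "v \<in> vecs (Suc n) \<Longrightarrow> v(n := 0) \<in> vecs n"
  by (auto simp: vecs_def)

lemma vecs_Suc_zero: "v \<in> vecs (Suc n) \<Longrightarrow> v n = 0 \<Longrightarrow> v \<in> vecs n"
  using vecs_upd_zero[of v n] by (metis fun_upd_triv)

lemma zero_in_vecs [simp]: "0 \<in> vecs n"
  by (rule vs.subspace_0[OF subspace_vecs])

lemma reach_subset_vecs: "reach n m N t \<subseteq> vecs m"
  by (auto simp: reach_def)

lemma finite_reach: "finite (reach n m (N :: nat \<Rightarrow> nat \<Rightarrow> 'k::{field,finite}) t)"
  by (rule finite_subset[OF reach_subset_vecs finite_vecs])

lemma reach_mono:
  assumes "t \<le> u" shows "reach n m N t \<subseteq> reach n m N u"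
proof -
  have "reach n m N t \<subseteq> reach n m N (Suc t)" for t
    by (auto simp: reach_def)
  then show ?thesis using assms by (rule lift_Suc_mono_le)
qed

text \<open>Project the new kernel to the last coordinate. Coordinate 0 gives the old kernel. The
  image is the whole field or 0: a vector \<open>v\<close> with last coordinate \<open>c\<close>
  lies in the kernel when N^(t+1) v + c N^t w = 0, and for nonzero \<open>c\<close> this puts
  \<open>w\<close> in \<open>reach\<close>.\<close>

lemma card_kernel_addcol:
  fixes N :: "nat \<Rightarrow> nat \<Rightarrow> 'k::{field,finite}"
  assumes "N \<in> mats n" "m \<le> n" "w \<in> vecs m"
  shows "card {v \<in> vecs (Suc n). (mapply (Suc n) (addcol n N w) ^^ Suc t) v = 0} =
    card {v \<in> vecs n. (mapply n N ^^ Suc t) v = 0} * CARD('k) ^ of_bool (w \<in> reach n m N t)"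
proof -
  define f where "f = mapply n N"
  define g where "g = mapply (Suc n) (addcol n N w)"
  define K where "K = {v \<in> vecs (Suc n). (g ^^ Suc t) v = 0}"
  have w: "w \<in> vecs n" using assms vecs_mono by blast
  have g: "g v = f v + fscale (v n) w" for v
    unfolding f_def g_def by (rule mapply_addcol[OF w assms(1)])
  have g_vecs: "g v \<in> vecs n" for v
    unfolding g f_def by (intro vs.subspace_add vs.subspace_scale subspace_vecs w mapply_in_vecs)
  have g_f: "g v = f v" if "v \<in> vecs n" for v
    using that by (simp add: g vecs_def)
  have g_pow: "(g ^^ i) v = (f ^^ i) v" if "v \<in> vecs n" for i v
  proof (induction i)
    case (Suc i)
    have "(f ^^ i) v \<in> vecs n" unfolding f_def by (rule mapply_pow_in_vecs[OF that])
    then show ?case using Suc g_f by simp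
  qed simp
  have g_pow_Suc: "(g ^^ Suc t) v = (f ^^ t) (f v) + fscale (v n) ((f ^^ t) w)" for v
  proof -
    have "(g ^^ Suc t) v = (f ^^ t) (g v)"
      using g_pow[OF g_vecs] by (simp add: funpow_Suc_right del: funpow.simps)
    then show ?thesis by (simp add: g f_def mapply_pow_add mapply_pow_fscale)
  qed
  have K: "vs.subspace K" unfolding K_def g_def by (rule subspace_kernel[OF subspace_vecs])
  have "card K = card {v \<in> K. v n = 0} * card ((\<lambda>v. v n) ` K)"
    using vs.subspace_add[OF K] vs.subspace_diff[OF K]
    by (intro card_eq_card_kernel_times_card_image)
      (auto simp: K_def finite_vecs plus_fun_apply)
  moreover have "{v \<in> K. v n = 0} = {v \<in> vecs n. (f ^^ Suc t) v = 0}"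
  proof -
    have "v \<in> K \<and> v n = 0 \<longleftrightarrow> v \<in> vecs n \<and> (f ^^ Suc t) v = 0" for v
    proof -
      have "v \<in> vecs n \<longleftrightarrow> v \<in> vecs (Suc n) \<and> v n = 0"
        using vecs_Suc_zero[of v n] vecs_mono[of n "Suc n"] by (auto simp: vecs_def)
      then show ?thesis using g_pow[of v "Suc t"] unfolding K_def by auto
    qed
    then show ?thesis by blast
  qed
  moreover have "card ((\<lambda>v. v n) ` K) = CARD('k) ^ of_bool (w \<in> reach n m N t)"
  proof (cases "w \<in> reach n m N t")
    case True
    then obtain u where u: "u \<in> vecs n" "(f ^^ t) w = (f ^^ Suc t) u"
      by (auto simp: reach_def f_def)
    have "c \<in> (\<lambda>v. v n) ` K" for c
    \<comment> \<open>The first power of \<open>g\<close> sends this vector to c (w - f u), which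
      \<open>f ^^ t\<close> kills by the choice of \<open>u\<close>. Setting entry \<open>n\<close>
      does not affect \<open>f\<close>.\<close>
    proof (rule image_eqI[of _ _ "(fscale (- c) u)(n := c)"])
      let ?v = "(fscale (- c) u)(n := c)"
      show "c = ?v n" by simp
      have "f ?v = fscale (- c) (f u)" by (simp only: f_def mapply_fun_upd mapply_fscale)
      then have "(g ^^ Suc t) ?v = fscale (- c) ((f ^^ Suc t) u) + fscale c ((f ^^ Suc t) u)"
        unfolding g_pow_Suc u(2)
        by (simp add: f_def mapply_pow_fscale[symmetric] funpow_Suc_right del: funpow.simps vs.scale_minus_left)
      then have "(g ^^ Suc t) ?v = 0" by simp
      moreover have "?v \<in> vecs (Suc n)" using u(1) by (auto simp: vecs_def fscale_def)
      ultimately show "?v \<in> K" by (simp add: K_def del: funpow.simps)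
    qed
    then have "(\<lambda>v. v n) ` K = UNIV" by blast
    then show ?thesis using True by simp
  next
    case False
    have "v n = 0" if v: "v \<in> K" for v
    proof (rule ccontr)
      assume "v n \<noteq> 0"
      \<comment> \<open>The kernel equation solved for \<open>(f ^^ t) w\<close>. Clearing the last
        entry of \<open>v\<close> puts the preimage in \<open>vecs n\<close> and leaves
        \<open>f v\<close> unchanged.\<close>
      let ?u = "fscale (- 1 / v n) (v(n := 0))"
      have "(f ^^ t) (f v) + fscale (v n) ((f ^^ t) w) = 0"
        using v g_pow_Suc[of v] by (simp add: K_def del: funpow.simps)
      then have "(f ^^ t) (f v) = fscale (- v n) ((f ^^ t) w)"
        by (simp add: eq_neg_iff_add_eq_0)
      then have "fscale (- 1 / v n) ((f ^^ t) (f v)) = fscale (- 1 / v n) (fscale (- v n) ((f ^^ t) w))"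
        by (simp only:)
      also have "\<dots> = (f ^^ t) w" using \<open>v n \<noteq> 0\<close> by simp
      finally have "(f ^^ t) w = (f ^^ Suc t) ?u"
        unfolding funpow_Suc_right comp_apply
        by (simp only: f_def mapply_pow_fscale mapply_fscale mapply_fun_upd)
      moreover have "?u \<in> vecs n"
        using v by (intro vs.subspace_scale subspace_vecs vecs_upd_zero) (simp add: K_def)
      ultimately have "w \<in> reach n m N t" using assms(3) by (auto simp: reach_def f_def)
      then show False using False by simp
    qed
    moreover have "0 \<in> K" by (rule vs.subspace_0[OF K])
    ultimately have "(\<lambda>v. v n) ` K = {0}"
      by (auto simp: zero_fun_apply intro!: image_eqI[of _ _ 0])
    then show ?thesis using False by simp
  qed
  ultimately show ?thesis by (simp add: K_def f_def g_def del: funpow.simps)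
qed

text \<open>The sum of rows 0 to \<open>t\<close> is the dimension of the kernel of the power
  \<open>t + 1\<close>. It grows by one exactly from the least index with \<open>w\<close> in
  \<open>reach\<close> onwards, because \<open>reach\<close> increases; consecutive differences
  isolate one row. Nilpotency on \<open>w\<close> makes this index exist.\<close>

lemma JF_addcol:
  fixes N :: "nat \<Rightarrow> nat \<Rightarrow> 'k::{field,finite}"
  assumes "N \<in> mats n" "m \<le> n" "w \<in> vecs m" and nilp: "(mapply n N ^^ K) w = 0"
  shows "JF (Suc n) (addcol n N w) =
    (\<lambda>i. JF n N i + of_bool (i = (LEAST t. w \<in> reach n m N t)))"
proof -
  define T where "T = (LEAST t. w \<in> reach n m N t)"
  let ?F = "JF (Suc n) (addcol n N w)"
  have w: "w \<in> reach n m N K"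
    using assms by (auto simp: reach_def mapply_pow_zero simp del: funpow.simps intro!: image_eqI[of _ _ 0])
  have T: "w \<in> reach n m N t \<longleftrightarrow> T \<le> t" for t
  proof
    show "T \<le> t" if "w \<in> reach n m N t"
      unfolding T_def using that by (rule Least_le)
    have "w \<in> reach n m N T"
      unfolding T_def using w by (rule LeastI)
    then show "w \<in> reach n m N t" if "T \<le> t"
      using reach_mono[OF that] by blast
  qed
  have "CARD('k) ^ (\<Sum>i<Suc t. ?F i) = CARD('k) ^ ((\<Sum>i<Suc t. JF n N i) + of_bool (T \<le> t))" for t
    unfolding JF_def power_add
    using card_kernel_addcol[OF assms(1-3), of t]
    unfolding card_kernel[OF subspace_vecs finite_vecs] T .
  then have sums: "(\<Sum>i<Suc t. ?F i) = (\<Sum>i<Suc t. JF n N i) + of_bool (T \<le> t)" for t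
    using power_inject_exp[OF CARD_field_gt_1[where 'k = 'k]] by blast
  show ?thesis unfolding T_def[symmetric]
  proof
    fix i
    show "?F i = JF n N i + of_bool (i = T)"
      using sums[of i] sums[of "i - 1"] by (cases i) (auto simp: of_bool_def le_Suc_eq split: if_splits)
  qed
qed

text \<open>\<open>N^t\<close> maps \<open>reach\<close> onto the image of \<open>vecs n\<close>
  under \<open>N^(t+1)\<close>, onto because \<open>N\<close> sends everything into
  \<open>vecs m\<close>; its kernel there is that of \<open>N^t\<close> in \<open>vecs m\<close>.
  The size of the image follows from the kernel of \<open>N^(t+1)\<close>. Cross-multiplied to stay
  in the naturals.\<close>

lemma card_reach:
  fixes N :: "nat \<Rightarrow> nat \<Rightarrow> 'k::{field,finite}"
  assumes "m \<le> n" and im: "\<And>v. mapply n N v \<in> vecs m"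
  shows "card (reach n m N t) * CARD('k) ^ (\<Sum>i<Suc t. JF n N i)
    = CARD('k) ^ (\<Sum>i<t. JF_on n N (vecs m) i) * CARD('k) ^ n"
proof -
  let ?f = "mapply n N"
  have add: "x + y \<in> reach n m N t" and diff: "x - y \<in> reach n m N t"
    if xy: "x \<in> reach n m N t" "y \<in> reach n m N t" for x y
  proof -
    obtain u v where uv: "u \<in> vecs n" "(?f ^^ t) x = (?f ^^ Suc t) u" "v \<in> vecs n" "(?f ^^ t) y = (?f ^^ Suc t) v"
      using xy by (auto simp: reach_def simp del: funpow.simps)
    have xy: "x \<in> vecs m" "y \<in> vecs m" using xy by (auto simp: reach_def)
    have "x + fscale c y \<in> reach n m N t" for c
    proof -
      have "(?f ^^ t) (x + fscale c y) = (?f ^^ Suc t) (u + fscale c v)"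
        using uv by (simp only: mapply_pow_add mapply_pow_fscale)
      then show ?thesis unfolding reach_def
        using uv xy by (blast intro: vs.subspace_add vs.subspace_scale subspace_vecs)
    qed
    from this[of 1] this[of "-1"] show "x + y \<in> reach n m N t" "x - y \<in> reach n m N t" by simp_all
  qed
  have "card (reach n m N t) = card {w \<in> reach n m N t. (?f ^^ t) w = 0} * card ((?f ^^ t) ` reach n m N t)"
    by (intro card_eq_card_kernel_times_card_image finite_reach add diff mapply_pow_add)
  also have "{w \<in> reach n m N t. (?f ^^ t) w = 0} = {w \<in> vecs m. (?f ^^ t) w = 0}"
    by (auto simp: reach_def mapply_pow_zero simp del: funpow.simps
        intro!: image_eqI[of _ _ 0])
  also have "card \<dots> = CARD('k) ^ (\<Sum>i<t. JF_on n N (vecs m) i)"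
    by (rule card_kernel[OF subspace_vecs finite_vecs])
  also have "(?f ^^ t) ` reach n m N t = (?f ^^ Suc t) ` vecs n"
    unfolding reach_def using im
    by (auto simp: funpow_Suc_right simp del: funpow.simps intro!: imageI)
  finally have 1: "card (reach n m N t) =
    CARD('k) ^ (\<Sum>i<t. JF_on n N (vecs m) i) * card ((?f ^^ Suc t) ` vecs n)" .
  have "card (vecs n :: (nat \<Rightarrow> 'k) set) = card {v \<in> vecs n. (?f ^^ Suc t) v = 0} * card ((?f ^^ Suc t) ` vecs n)"
    by (intro card_eq_card_kernel_times_card_image finite_vecs vs.subspace_add[OF subspace_vecs]
        vs.subspace_diff[OF subspace_vecs] mapply_pow_add)
  then have 2: "CARD('k) ^ n = CARD('k) ^ (\<Sum>i<Suc t. JF n N i) * card ((?f ^^ Suc t) ` vecs n)"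
    unfolding card_kernel[OF subspace_vecs finite_vecs] card_vecs JF_def .
  show ?thesis unfolding 1 2 by (simp add: ac_simps)
qed

text \<open>These columns form the difference of two consecutive \<open>reach\<close> sets, or the
  first set if \<open>t = 0\<close>. The exponent in the last factor is the number of boxes row
  \<open>t\<close> can still take in a horizontal strip over \<open>\<mu>\<close>; for a full row it
  is 0 and the count vanishes. The hypothesis \<open>strip\<close> keeps the subtraction from being
  truncated.\<close>

lemma card_Least_reach:
  fixes N :: "nat \<Rightarrow> nat \<Rightarrow> 'k::{field,finite}" and q :: real
  assumes q: "q = 1 / real CARD('k)" and mn: "m \<le> n" and im: "\<And>v. mapply n N v \<in> vecs m"
    and nilp: "\<And>v. v \<in> vecs m \<Longrightarrow> (mapply n N ^^ K) v = 0"
    and \<mu>: "JF_on n N (vecs m) = \<mu>" and JF: "JF n N = (\<lambda>i. \<mu> i + y i)"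
    and strip: "t > 0 \<Longrightarrow> \<mu> t + y t \<le> \<mu> (t - 1)"
  shows "real (card {w \<in> vecs m. (LEAST t. w \<in> reach n m N t) = t}) =
    real CARD('k) ^ n * q ^ (\<mu> t + (\<Sum>i\<le>t. y i)) * (if t = 0 then 1 else 1 - q ^ (\<mu> (t - 1) - \<mu> t - y t))"
proof -
  let ?Q = "real CARD('k)"
  have Q: "?Q > 0" by simp
  have card: "real (card (reach n m N i)) = ?Q ^ n * q ^ (\<mu> i + (\<Sum>l\<le>i. y l))" for i
  proof -
    have "real (card (reach n m N i)) * ?Q ^ (\<Sum>l<Suc i. \<mu> l + y l) = ?Q ^ (\<Sum>l<i. \<mu> l) * ?Q ^ n"
      using arg_cong[OF card_reach[OF mn im, of i], of real] unfolding JF \<mu> by simp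
    also have "(\<Sum>l<Suc i. \<mu> l + y l) = (\<Sum>l<i. \<mu> l) + (\<mu> i + (\<Sum>l\<le>i. y l))"
      by (simp add: sum.distrib lessThan_Suc_atMost[symmetric] del: sum.lessThan_Suc)
        (simp add: lessThan_Suc)
    finally have "real (card (reach n m N i)) * ?Q ^ (\<mu> i + (\<Sum>l\<le>i. y l)) = ?Q ^ n"
      by (simp add: power_add)
    then show ?thesis by (simp add: q power_one_over field_simps)
  qed
  note fin = finite_reach[of n m N]
  \<comment> \<open>By nilpotency \<open>reach\<close> exhausts \<open>vecs m\<close>, so every
    least index exists.\<close>
  have vecs: "vecs m = reach n m N K"
    using nilp by (auto simp: reach_def mapply_pow_zero simp del: funpow.simps intro!: image_eqI[of _ _ 0])
  have LeastI': "w \<in> reach n m N (LEAST t. w \<in> reach n m N t)" if "w \<in> vecs m" for w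
    using LeastI[of "\<lambda>t. w \<in> reach n m N t" K] that vecs by simp
  show ?thesis
  proof (cases t)
    case 0
    have "(LEAST t. w \<in> reach n m N t) = 0 \<longleftrightarrow> w \<in> reach n m N 0" if "w \<in> vecs m" for w
      using LeastI'[OF that] Least_eq_0[of "\<lambda>t. w \<in> reach n m N t"] by auto
    then have "{w \<in> vecs m. (LEAST t. w \<in> reach n m N t) = 0} = reach n m N 0"
      using reach_subset_vecs[of n m N 0] by blast
    then show ?thesis using card[of 0] 0 by simp
  next
    case (Suc s)
    have "(LEAST t. w \<in> reach n m N t) = t \<longleftrightarrow> w \<in> reach n m N t - reach n m N s" if "w \<in> vecs m" for w
    proof
      assume "(LEAST t. w \<in> reach n m N t) = t"
      then show "w \<in> reach n m N t - reach n m N s"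
        using LeastI'[OF that] Suc not_less_Least[of s "\<lambda>t. w \<in> reach n m N t"] by auto
    next
      assume w: "w \<in> reach n m N t - reach n m N s"
      show "(LEAST t. w \<in> reach n m N t) = t"
      proof (rule Least_equality)
        show "w \<in> reach n m N t" using w by simp
        show "t \<le> i" if "w \<in> reach n m N i" for i
          using reach_mono[of i s n m N] w that Suc by (cases "i \<le> s") auto
      qed
    qed
    then have "{w \<in> vecs m. (LEAST t. w \<in> reach n m N t) = t} = reach n m N t - reach n m N s"
      using reach_subset_vecs[of n m N t] by blast
    then have "real (card {w \<in> vecs m. (LEAST t. w \<in> reach n m N t) = t})
      = real (card (reach n m N t)) - real (card (reach n m N s))"
      using card_Diff_subset[of "reach n m N s" "reach n m N t"] reach_mono[of s t n m N] fin Suc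
        card_mono[of "reach n m N t" "reach n m N s"]
      by (simp add: of_nat_diff)
    also have "\<dots> = ?Q ^ n * (q ^ (\<mu> t + (\<Sum>l\<le>t. y l)) - q ^ (\<mu> s + (\<Sum>l\<le>s. y l)))"
      unfolding card by (simp add: algebra_simps)
    also have "\<mu> s + (\<Sum>l\<le>s. y l) = (\<mu> t + (\<Sum>l\<le>t. y l)) + (\<mu> s - \<mu> t - y t)"
      using strip Suc by simp
    finally show ?thesis using Suc by (simp add: power_add algebra_simps)
  qed
qed

section \<open>Adding a block of columns\<close>

lemma mapply_colext:
  assumes "N \<in> colext m b M"
  shows "mapply (m + b) N v \<in> vecs m" "v \<in> vecs m \<Longrightarrow> mapply (m + b) N v = mapply m M v"
proof -
  show "mapply (m + b) N v \<in> vecs m"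
    using assms by (auto simp: colext_def mapply_def vecs_def)
  assume v: "v \<in> vecs m"
  have "(\<Sum>s<m + b. N r s * v s) = (\<Sum>s<m. M r s * v s)" for r
  proof -
    have "(\<Sum>s<m + b. N r s * v s) = (\<Sum>s<m. N r s * v s)"
      using v by (intro sum.mono_neutral_right) (auto simp: vecs_def)
    then show ?thesis using assms by (simp add: colext_def)
  qed
  moreover have "(\<Sum>s<m + b. N r s * v s) = 0" if "r \<ge> m" for r
    using assms that by (simp add: colext_def)
  ultimately show "mapply (m + b) N v = mapply m M v"
    by (auto simp: mapply_def fun_eq_iff)
qed

lemma JF_on_colext:
  assumes "N \<in> colext m b M" "F \<subseteq> vecs m"
  shows "JF_on (m + b) N F = JF_on m M F"
  by (rule JF_on_cong[where V = "vecs m"])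
    (use assms mapply_colext(2)[OF assms(1)] mapply_in_vecs in auto)

lemma mapply_pow_colext:
  assumes "N \<in> colext m b M" "v \<in> vecs m"
  shows "(mapply (m + b) N ^^ i) v = (mapply m M ^^ i) v"
proof (induction i)
  case (Suc i)
  have "(mapply m M ^^ i) v \<in> vecs m" using assms(2) by (rule mapply_pow_in_vecs)
  then show ?case using Suc mapply_colext(2)[OF assms(1)] by simp
qed simp

lemma bij_betw_addcol:
  "bij_betw (\<lambda>(N, w). addcol (m + b) N w) (colext m b M \<times> vecs m) (colext m (Suc b) M)"
proof (rule bij_betw_byWitness)
  let ?g = "\<lambda>N. (\<lambda>r s. if s = m + b then 0 else N r s, \<lambda>r. N r (m + b))"
  show "\<forall>a\<in>colext m b M \<times> vecs m. ?g (case a of (N, w) \<Rightarrow> addcol (m + b) N w) = a"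
    by (auto simp: colext_def mats_def addcol_def fun_eq_iff)
  show "\<forall>N\<in>colext m (Suc b) M. (case ?g N of (N, w) \<Rightarrow> addcol (m + b) N w) = N"
    by (auto simp: addcol_def fun_eq_iff)
  show "(\<lambda>(N, w). addcol (m + b) N w) ` (colext m b M \<times> vecs m) \<subseteq> colext m (Suc b) M"
    by (auto simp: colext_def mats_def addcol_def vecs_def)
  show "?g ` colext m (Suc b) M \<subseteq> colext m b M \<times> vecs m"
    by (auto simp: colext_def mats_def vecs_def)
qed

lemma colext_0: "M \<in> mats m \<Longrightarrow> colext m 0 M = {M}"
  by (auto simp: colext_def mats_def fun_eq_iff) (metis linorder_not_less)+

lemma finite_colext:
  fixes M :: "nat \<Rightarrow> nat \<Rightarrow> 'k::{field,finite}"
  assumes "M \<in> mats m"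
  shows "finite (colext m b M)"
proof (induction b)
  case (Suc b)
  then show ?case
    using bij_betw_finite[OF bij_betw_addcol[of m b M]] by (simp add: finite_vecs)
qed (simp add: colext_0 assms)

section \<open>q-integers and the closed form for one block\<close>

lemma qint_0 [simp]: "qint q 0 = 0"
  by (simp add: qint_def)

lemma qint_add: "qint q (a + b) = qint q a + q ^ a * qint q b"
  by (induction b) (simp_all add: qint_def algebra_simps power_add)

lemma qint_pos: "q > 0 \<Longrightarrow> m > 0 \<Longrightarrow> qint q m > 0"
  unfolding qint_def by (intro sum_pos) auto

lemma qfact_0 [simp]: "qfact q 0 = 1"
  by (simp add: qfact_def)

lemma qfact_Suc: "qfact q (Suc m) = qfact q m * qint q (Suc m)"
  by (simp add: qfact_def atLeastAtMostSuc_conv mult.commute)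

lemma qfact_pos: "q > 0 \<Longrightarrow> qfact q m > 0"
  by (induction m) (simp_all add: qfact_Suc qint_pos)

text \<open>Intervals of exponents of lengths \<open>x t\<close>, laid end to end, fill one
  interval.\<close>

lemma qint_sum: "(\<Sum>t<(R::nat). qint q (x t) * q ^ (\<Sum>i<t. x i)) = qint q (\<Sum>i<R. x i)"
  by (induction R) (simp_all add: qint_add)

text \<open>Box number \<open>j\<close> of row \<open>i\<close> contributes 1 - q^(free places) and
  q^(\<mu> i + j) to the column count. The division by \<open>qfact q k\<close>, together with the
  factorial in \<open>strip_count\<close>, forms a q-multinomial coefficient that accounts for the
  order in which the rows receive their boxes.\<close>

definition row_factor :: "real \<Rightarrow> (nat \<Rightarrow> nat) \<Rightarrow> nat \<Rightarrow> nat \<Rightarrow> real" where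
  "row_factor q \<mu> i k = (\<Prod>j<k. if i = 0 then 1 else 1 - q ^ (\<mu> (i - 1) - \<mu> i - j))
     * q ^ (\<mu> i * k + (k choose 2)) / qfact q k"

text \<open>The power of 1 / q collects the sizes of the spaces of dimension m, m + 1, ..., m + b -
  1 met while the columns are added.\<close>

definition strip_count :: "real \<Rightarrow> nat \<Rightarrow> nat \<Rightarrow> (nat \<Rightarrow> nat) \<Rightarrow> (nat \<Rightarrow> nat) \<Rightarrow> real" where
  "strip_count q R m \<mu> x = (let b = \<Sum>i<R. x i in
     qfact q b * (1 / q) ^ (m * b + (b choose 2)) * (\<Prod>i<R. row_factor q \<mu> i (x i)))"

lemma row_factor_0 [simp]: "row_factor q \<mu> i 0 = 1"
  by (simp add: row_factor_def binomial_eq_0)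

lemma row_factor_Suc:
  "row_factor q \<mu> i (Suc k) = row_factor q \<mu> i k
     * (if i = 0 then 1 else 1 - q ^ (\<mu> (i - 1) - \<mu> i - k)) * q ^ (\<mu> i + k) / qint q (Suc k)"
  by (simp add: row_factor_def qfact_Suc power_add algebra_simps numeral_2_eq_2)

text \<open>In the quotient of the two closed forms all factors cancel against the number of columns
  with box in row \<open>t\<close>, except the q-integers and a power of \<open>q\<close>. What
  remains is the share of extensions whose last box lies in row \<open>t\<close>.\<close>

lemma strip_count_remove_box:
  assumes q: "q > 0" and x: "(\<Sum>i<R. x i) = Suc b" and t: "t < R" "x t > 0"
  shows "strip_count q R m \<mu> (x(t := x t - 1)) * ((1 / q) ^ (m + b)
      * q ^ (\<mu> t + (\<Sum>i\<le>t. (x(t := x t - 1)) i)) * (if t = 0 then 1 else 1 - q ^ (\<mu> (t - 1) - \<mu> t - (x t - 1))))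
    = strip_count q R m \<mu> x * (qint q (x t) * q ^ (\<Sum>i<t. x i)) / qint q (Suc b)"
proof -
  obtain k where k: "x t = Suc k" using t(2) gr0_implies_Suc by blast
  define S where "S = (\<Sum>i<t. x i)"
  define P where "P = (\<Prod>i\<in>{..<R} - {t}. row_factor q \<mu> i (x i))"
  define c where "c = (if t = 0 then 1 else 1 - q ^ (\<mu> (t - 1) - \<mu> t - k))"
  have prod_x: "(\<Prod>i<R. row_factor q \<mu> i (x i)) = row_factor q \<mu> t (Suc k) * P"
    unfolding P_def using prod.remove[of "{..<R}" t "\<lambda>i. row_factor q \<mu> i (x i)"] t k by simp
  have prod_y: "(\<Prod>i<R. row_factor q \<mu> i ((x(t := k)) i)) = row_factor q \<mu> t k * P"
    unfolding P_def using prod.remove[of "{..<R}" t "\<lambda>i. row_factor q \<mu> i ((x(t := k)) i)"] t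
    by simp
  have sum_y: "(\<Sum>i<R. (x(t := k)) i) = b"
  proof -
    have "(\<Sum>i<R. x i) = Suc k + (\<Sum>i\<in>{..<R} - {t}. x i)"
      using sum.remove[of "{..<R}" t x] t k by simp
    moreover have "(\<Sum>i<R. (x(t := k)) i) = k + (\<Sum>i\<in>{..<R} - {t}. x i)"
      using sum.remove[of "{..<R}" t "x(t := k)"] t by simp
    ultimately show ?thesis using x by simp
  qed
  have sum_le: "(\<Sum>i\<le>t. (x(t := k)) i) = S + k"
    by (simp add: S_def lessThan_Suc_atMost[symmetric])
  have "qint q (Suc k) > 0" "qint q (Suc b) > 0" using q qint_pos by auto
  then show ?thesis
    using q unfolding strip_count_def Let_def k diff_Suc_1 sum_y prod_x prod_y x sum_le
      row_factor_Suc qfact_Suc S_def[symmetric] c_def[symmetric]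
    by (simp add: power_add algebra_simps numeral_2_eq_2 power_one_over)
qed

lemma strip_count_recurrence:
  assumes q: "q > 0" and x: "(\<Sum>i<R. x i) = Suc b"
  shows "strip_count q R m \<mu> x = (\<Sum>t\<in>{t. t < R \<and> 0 < x t}.
      strip_count q R m \<mu> (x(t := x t - 1)) * ((1 / q) ^ (m + b)
      * q ^ (\<mu> t + (\<Sum>i\<le>t. (x(t := x t - 1)) i)) * (if t = 0 then 1 else 1 - q ^ (\<mu> (t - 1) - \<mu> t - (x t - 1)))))"
    (is "_ = ?rhs")
proof -
  have "?rhs = (\<Sum>t\<in>{t. t < R \<and> 0 < x t}. strip_count q R m \<mu> x * (qint q (x t) * q ^ (\<Sum>i<t. x i)) / qint q (Suc b))"
    by (intro sum.cong refl strip_count_remove_box q x) auto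
  \<comment> \<open>Rows without a box contribute \<open>qint q 0 = 0\<close>, so the sum may run
    over all rows.\<close>
  also have "\<dots> = (\<Sum>t<R. strip_count q R m \<mu> x * (qint q (x t) * q ^ (\<Sum>i<t. x i)) / qint q (Suc b))"
    by (intro sum.mono_neutral_left) auto
  also have "\<dots> = strip_count q R m \<mu> x * (\<Sum>t<R. qint q (x t) * q ^ (\<Sum>i<t. x i)) / qint q (Suc b)"
    by (simp add: sum_distrib_left sum_divide_distrib)
  also have "\<dots> = strip_count q R m \<mu> x"
    unfolding qint_sum x using qint_pos[OF q, of "Suc b"] by simp
  finally show ?thesis by simp
qed

text \<open>Induction on the number of columns with \<open>\<mu>\<close> fixed: removing the last
  column takes one box out of the strip. The smaller strip inherits the bound, which compares with
  \<open>\<mu>\<close> only.\<close>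

lemma card_colext_JF:
  fixes M :: "nat \<Rightarrow> nat \<Rightarrow> 'k::{field,finite}" and q :: real
  assumes q: "q = 1 / real CARD('k)" and M: "M \<in> mats m"
    and nilp: "\<And>v. v \<in> vecs m \<Longrightarrow> (mapply m M ^^ K) v = 0"
    and \<mu>: "JF m M = \<mu>"
    and strip: "\<And>i. \<mu> (Suc i) + x (Suc i) \<le> \<mu> i"
    and supp: "\<And>i. i \<ge> R \<Longrightarrow> x i = 0" and size: "(\<Sum>i<R. x i) = b"
  shows "real (card {N \<in> colext m b M. JF (m + b) N = (\<lambda>i. \<mu> i + x i)}) = strip_count q R m \<mu> x"
  using strip supp size
proof (induction b arbitrary: x)
  case 0
  have x: "x = (\<lambda>_. 0)"
    using 0 by (metis (no_types, lifting) finite_lessThan lessThan_iff linorder_not_less sum_eq_0_iff)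
  have "{N \<in> colext m 0 M. JF (m + 0) N = (\<lambda>i. \<mu> i + x i)} = {M}"
    using \<mu> by (auto simp: colext_0[OF M] x)
  then show ?case by (simp add: x strip_count_def numeral_2_eq_2)
next
  case (Suc b)
  let ?y = "\<lambda>t. x(t := x t - 1)"
  let ?T = "{t. t < R \<and> 0 < x t}"
  let ?least = "\<lambda>N w. LEAST t. w \<in> reach (m + b) m N t"
  let ?C = "\<lambda>t. {N \<in> colext m b M. JF (m + b) N = (\<lambda>i. \<mu> i + ?y t i)}"
  let ?B = "\<lambda>t. Sigma (?C t) (\<lambda>N. {w \<in> vecs m. ?least N w = t})"
  let ?h = "\<lambda>t. (1 / q) ^ (m + b) * q ^ (\<mu> t + (\<Sum>i\<le>t. ?y t i))
      * (if t = 0 then 1 else 1 - q ^ (\<mu> (t - 1) - \<mu> t - (x t - 1)))"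
  let ?add = "\<lambda>(N, w). addcol (m + b) N w"
  have q0: "q > 0" using q by simp
  have nilp': "(mapply (m + b) N ^^ K) v = 0" if "N \<in> colext m b M" "v \<in> vecs m" for N v
    using mapply_pow_colext[OF that] nilp that by simp
  have \<mu>': "JF_on (m + b) N (vecs m) = \<mu>" if "N \<in> colext m b M" for N
    using JF_on_colext[OF that, of "vecs m"] \<mu> by (simp add: JF_def)
  have JF_add: "JF (m + Suc b) (addcol (m + b) N w) = (\<lambda>i. JF (m + b) N i + of_bool (i = ?least N w))"
    if "N \<in> colext m b M" "w \<in> vecs m" for N w
    using JF_addcol[of N "m + b" m w K] nilp' that by (simp add: colext_def)
  have A: "{N \<in> colext m (Suc b) M. JF (m + Suc b) N = (\<lambda>i. \<mu> i + x i)} = ?add ` (\<Union>t\<in>?T. ?B t)"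
  proof (intro equalityI subsetI)
    fix N1 assume N1: "N1 \<in> {N \<in> colext m (Suc b) M. JF (m + Suc b) N = (\<lambda>i. \<mu> i + x i)}"
    then have "N1 \<in> ?add ` (colext m b M \<times> vecs m)"
      using bij_betw_imp_surj_on[OF bij_betw_addcol[of m b M]] by blast
    then obtain N w where N: "N \<in> colext m b M" "w \<in> vecs m" "N1 = addcol (m + b) N w" by auto
    define t where "t = ?least N w"
    have eq: "\<mu> i + x i = JF (m + b) N i + of_bool (i = t)" for i
      using N1 JF_add[OF N(1,2)] unfolding N(3) t_def by (simp add: fun_eq_iff)
    \<comment> \<open>The shape before the last column already contains \<open>\<mu>\<close>, so the
      box of that column cannot belong to \<open>\<mu>\<close> and \<open>x t\<close> is
      positive.\<close>
    have "\<mu> i \<le> JF (m + b) N i" for i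
      using JF_on_mono[OF subspace_vecs subspace_vecs finite_vecs vecs_mono, of m "m + b" "m + b" N i] \<mu>'[OF N(1)]
      by (simp add: JF_def)
    then have "x t > 0" using eq[of t] by (metis add_le_same_cancel1 gr0I le_add1 add.right_neutral add_leD1 not_one_le_zero of_bool_eq(2) nat_add_left_cancel_le order_trans)
    moreover have "t < R" using Suc.prems(2)[of t] \<open>x t > 0\<close> by (metis not_less less_irrefl)
    moreover have "JF (m + b) N = (\<lambda>i. \<mu> i + ?y t i)"
    proof
      fix i show "JF (m + b) N i = \<mu> i + ?y t i"
        using eq[of i] \<open>x t > 0\<close> by (cases "i = t") auto
    qed
    ultimately have "(N, w) \<in> (\<Union>t\<in>?T. ?B t)" using N t_def by blast
    then show "N1 \<in> ?add ` (\<Union>t\<in>?T. ?B t)" using N(3) by force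
  next
    fix N1 assume "N1 \<in> ?add ` (\<Union>t\<in>?T. ?B t)"
    then obtain t N w where N: "t \<in> ?T" "N \<in> ?C t" "w \<in> vecs m" "?least N w = t" "N1 = addcol (m + b) N w"
      by auto
    then have "N1 \<in> colext m (Suc b) M"
      using bij_betw_imp_surj_on[OF bij_betw_addcol[of m b M]] by blast
    moreover have "JF (m + Suc b) N1 = (\<lambda>i. \<mu> i + x i)"
    proof
      fix i
      have "JF (m + Suc b) N1 i = \<mu> i + ?y t i + of_bool (i = t)"
        using N JF_add[of N w] by simp
      then show "JF (m + Suc b) N1 i = \<mu> i + x i" using N(1) by (cases "i = t") auto
    qed
    ultimately show "N1 \<in> {N \<in> colext m (Suc b) M. JF (m + Suc b) N = (\<lambda>i. \<mu> i + x i)}" by simp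
  qed
  have finC: "finite (?C t)" for t using finite_colext[OF M] by simp
  have finB: "finite (?B t)" for t using finC by (intro finite_SigmaI) (auto simp: finite_vecs)
  have "inj_on ?add (\<Union>t\<in>?T. ?B t)"
    by (rule inj_on_subset[OF bij_betw_imp_inj_on[OF bij_betw_addcol[of m b M]]]) auto
  then have "card {N \<in> colext m (Suc b) M. JF (m + Suc b) N = (\<lambda>i. \<mu> i + x i)} = card (\<Union>t\<in>?T. ?B t)"
    unfolding A by (rule card_image)
  also have "\<dots> = (\<Sum>t\<in>?T. card (?B t))"
  proof (rule card_UN_disjoint)
    show "\<forall>t\<in>?T. finite (?B t)" using finB by blast
    show "\<forall>i\<in>?T. \<forall>j\<in>?T. i \<noteq> j \<longrightarrow> ?B i \<inter> ?B j = {}" by blast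
  qed simp
  finally have "real (card {N \<in> colext m (Suc b) M. JF (m + Suc b) N = (\<lambda>i. \<mu> i + x i)})
    = (\<Sum>t\<in>?T. real (card (?B t)))" by simp
  also have "\<dots> = (\<Sum>t\<in>?T. strip_count q R m \<mu> (?y t) * ?h t)"
  proof (rule sum.cong[OF refl])
    fix t assume t: "t \<in> ?T"
    have strip_y: "\<mu> (Suc i) + ?y t (Suc i) \<le> \<mu> i" for i
      using Suc.prems(1)[of i] by auto
    \<comment> \<open>The number of admissible last columns depends on \<open>N\<close> only through
      its shape, so each fibre of the \<open>Sigma\<close> has the same size.\<close>
    have fibre: "real (card {w \<in> vecs m. ?least N w = t}) = ?h t" if N: "N \<in> ?C t" for N
    proof -
      have "real (card {w \<in> vecs m. ?least N w = t}) =
        real CARD('k) ^ (m + b) * q ^ (\<mu> t + (\<Sum>i\<le>t. ?y t i)) * (if t = 0 then 1 else 1 - q ^ (\<mu> (t - 1) - \<mu> t - ?y t t))"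
        using N strip_y[of "t - 1"]
        by (intro card_Least_reach[OF q _ mapply_colext(1) nilp' \<mu>']) auto
      then show ?thesis by (simp add: q)
    qed
    have "real (card (?B t)) = (\<Sum>N\<in>?C t. real (card {w \<in> vecs m. ?least N w = t}))"
      using finC by (subst card_SigmaI) (auto simp: finite_vecs)
    also have "\<dots> = real (card (?C t)) * ?h t"
      by (simp only: sum.cong[OF refl fibre] sum_constant)
    also have "real (card (?C t)) = strip_count q R m \<mu> (?y t)"
    proof (rule Suc.IH)
      show "?y t i = 0" if "R \<le> i" for i using Suc.prems(2)[OF that] t that by auto
      have "(\<Sum>i<R. x i) = x t + (\<Sum>i\<in>{..<R} - {t}. x i)" using sum.remove[of "{..<R}" t x] t by simp
      moreover have "(\<Sum>i<R. ?y t i) = x t - 1 + (\<Sum>i\<in>{..<R} - {t}. x i)"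
        using sum.remove[of "{..<R}" t "?y t"] t by simp
      ultimately show "(\<Sum>i<R. ?y t i) = b" using Suc.prems(3) t by simp
    qed (rule strip_y)
    finally show "real (card (?B t)) = strip_count q R m \<mu> (?y t) * ?h t" .
  qed
  also have "\<dots> = strip_count q R m \<mu> x"
    by (rule strip_count_recurrence[OF q0 Suc.prems(3), symmetric])
  finally show ?case .
qed

section \<open>Chains of shapes\<close>

lemma choose_two_add: "(a + b) choose 2 = (a choose 2) + (b choose 2) + a * b"
  by (induction b) (simp_all add: numeral_2_eq_2)

lemma one_minus_times_qint: "(1 - q) * qint q m = 1 - q ^ m"
  by (simp add: qint_def one_diff_power_eq)

text \<open>Each factor is 1 - q times a q-integer, which leaves a falling q-factorial.\<close>

lemma prod_one_minus_power:
  assumes "q > 0" "k \<le> d"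
  shows "(\<Prod>j<k. 1 - q ^ (d - j)) = (1 - q) ^ k * qfact q d / qfact q (d - k)"
  using assms(2)
proof (induction k)
  case 0
  then show ?case using qfact_pos[OF assms(1), of d] by simp
next
  case (Suc k)
  then have "d - k = Suc (d - Suc k)" by simp
  then have fact: "qfact q (d - k) = qfact q (d - Suc k) * qint q (d - k)"
    using qfact_Suc[of q "d - Suc k"] by simp
  have pos: "qint q (d - k) > 0" using qint_pos[OF assms(1), of "d - k"] Suc.prems by simp
  have "(\<Prod>j<Suc k. 1 - q ^ (d - j)) = (1 - q) ^ k * qfact q d / qfact q (d - k) * ((1 - q) * qint q (d - k))"
    using Suc by (simp add: one_minus_times_qint)
  also have "\<dots> = (1 - q) ^ Suc k * qfact q d / qfact q (d - Suc k)"
    unfolding fact using pos by simp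
  finally show ?case .
qed

text \<open>The reciprocal of the constant in the theorem for size \<open>m\<close> and shape
  \<open>\<mu>\<close>, without the factorials of the content; \<open>R\<close> bounds the number of
  rows.\<close>

definition normalizer :: "real \<Rightarrow> nat \<Rightarrow> nat \<Rightarrow> (nat \<Rightarrow> nat) \<Rightarrow> real" where
  "normalizer q R m \<mu> = (1 / q) ^ (m choose 2) * q ^ (\<Sum>i<R. \<mu> i choose 2) * (1 - q) ^ (m - \<mu> 0)
     / (\<Prod>i<R. qfact q (\<mu> i - \<mu> (Suc i)))"

text \<open>The part of \<open>wt\<close> belonging to one entry value, with \<open>\<mu>\<close>
  and \<open>\<nu>\<close> the shapes before and after it.\<close>

definition strip_weight :: "real \<Rightarrow> nat \<Rightarrow> (nat \<Rightarrow> nat) \<Rightarrow> (nat \<Rightarrow> nat) \<Rightarrow> real" where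
  "strip_weight q R \<mu> \<nu> = (\<Prod>i<R. qbinom q (\<nu> i - \<nu> (Suc i)) (\<nu> i - \<mu> i))"

text \<open>One step of the telescoping. The falling factorials cancel the denominator of the old
  normalizer; the leftover factorials of \<open>\<nu> i - \<mu> i\<close> and
  \<open>\<mu> i - \<nu> (Suc i)\<close> are the denominators of the q-binomials. Powers of
  \<open>q\<close> match by C(a+b,2) = C(a,2) + C(b,2) + ab, used for the sizes and in each
  row.\<close>

lemma strip_count_normalizer:
  assumes q: "q > 0" and le: "\<And>i. \<mu> i \<le> \<nu> i" and strip: "\<And>i. \<nu> (Suc i) \<le> \<mu> i"
    and R: "\<nu> (Suc R) = 0" and size: "(\<Sum>i<Suc R. \<nu> i - \<mu> i) = b" and m: "\<mu> 0 \<le> m"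
  shows "strip_count q (Suc R) m \<mu> (\<lambda>i. \<nu> i - \<mu> i) * normalizer q (Suc R) m \<mu>
    = qfact q b * strip_weight q (Suc R) \<mu> \<nu> * normalizer q (Suc R) (m + b) \<nu>"
proof -
  let ?x = "\<lambda>i. \<nu> i - \<mu> i"
  let ?F = "\<lambda>g. \<Prod>i<Suc R. qfact q (g i)"
  have pos: "?F g > 0" for g by (intro prod_pos ballI qfact_pos[OF q])
  have nz: "?F g \<noteq> 0" for g using pos[of g] by linarith
  have x0: "?x 0 \<le> b" using member_le_sum[of 0 "{..<Suc R}" ?x] size by simp
  have size_tail: "(\<Sum>i<R. ?x (Suc i)) = b - ?x 0"
    using size unfolding sum.lessThan_Suc_shift by linarith
  have "(\<Prod>i<Suc R. \<Prod>j<?x i. if i = 0 then 1 else 1 - q ^ (\<mu> (i - 1) - \<mu> i - j))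
    = (\<Prod>i<R. (1 - q) ^ ?x (Suc i) * qfact q (\<mu> i - \<mu> (Suc i)) / qfact q (\<mu> i - \<nu> (Suc i)))"
    unfolding prod.lessThan_Suc_shift
    using prod_one_minus_power[OF q, of "?x (Suc i)" "\<mu> i - \<mu> (Suc i)" for i] le strip
    by (auto intro!: prod.cong simp: diff_le_mono)
  also have "\<dots> = (\<Prod>i<R. (1 - q) ^ ?x (Suc i)) * ((\<Prod>i<R. qfact q (\<mu> i - \<mu> (Suc i))) / (\<Prod>i<R. qfact q (\<mu> i - \<nu> (Suc i))))"
    by (simp add: prod.distrib prod_dividef)
  also have "(\<Prod>i<R. (1 - q) ^ ?x (Suc i)) = (1 - q) ^ (b - ?x 0)"
    unfolding power_sum[symmetric] size_tail ..
  \<comment> \<open>The extra last factor is \<open>qfact q (\<mu> R)\<close> above and below, since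
    both shapes vanish in row \<open>Suc R\<close>.\<close>
  also have "(\<Prod>i<R. qfact q (\<mu> i - \<mu> (Suc i))) / (\<Prod>i<R. qfact q (\<mu> i - \<nu> (Suc i)))
    = ?F (\<lambda>i. \<mu> i - \<mu> (Suc i)) / ?F (\<lambda>i. \<mu> i - \<nu> (Suc i))"
    using R le[of "Suc R"] qfact_pos[OF q, of "\<mu> R"] by simp
  finally have P: "(\<Prod>i<Suc R. \<Prod>j<?x i. if i = 0 then 1 else 1 - q ^ (\<mu> (i - 1) - \<mu> i - j))
    = (1 - q) ^ (b - ?x 0) * (?F (\<lambda>i. \<mu> i - \<mu> (Suc i)) / ?F (\<lambda>i. \<mu> i - \<nu> (Suc i)))" .
  have rows: "(\<Prod>i<Suc R. row_factor q \<mu> i (?x i)) =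
    (1 - q) ^ (b - ?x 0) * (?F (\<lambda>i. \<mu> i - \<mu> (Suc i)) / ?F (\<lambda>i. \<mu> i - \<nu> (Suc i)))
     * q ^ (\<Sum>i<Suc R. \<mu> i * ?x i + (?x i choose 2)) / ?F ?x"
    unfolding row_factor_def prod_dividef prod.distrib P power_sum ..
  have weight: "strip_weight q (Suc R) \<mu> \<nu> = ?F (\<lambda>i. \<nu> i - \<nu> (Suc i)) / (?F ?x * ?F (\<lambda>i. \<mu> i - \<nu> (Suc i)))"
  proof -
    have "qbinom q (\<nu> i - \<nu> (Suc i)) (?x i)
      = qfact q (\<nu> i - \<nu> (Suc i)) / (qfact q (?x i) * qfact q (\<mu> i - \<nu> (Suc i)))" for i
    proof -
      have "\<nu> i - \<nu> (Suc i) - ?x i = \<mu> i - \<nu> (Suc i)" using le[of i] strip[of i] by simp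
      then show ?thesis using diff_le_mono2[OF strip[of i], of "\<nu> i"] by (simp add: qbinom_def)
    qed
    then show ?thesis by (simp only: strip_weight_def prod_dividef prod.distrib)
  qed
  have e1: "m * b + (b choose 2) + (m choose 2) = (m + b) choose 2"
    by (simp add: choose_two_add)
  have e2: "(\<Sum>i<Suc R. \<mu> i * ?x i + (?x i choose 2)) + (\<Sum>i<Suc R. \<mu> i choose 2) = (\<Sum>i<Suc R. \<nu> i choose 2)"
    unfolding sum.distrib[symmetric]
  proof (rule sum.cong[OF refl])
    fix i show "\<mu> i * ?x i + (?x i choose 2) + (\<mu> i choose 2) = \<nu> i choose 2"
      using choose_two_add[of "\<mu> i" "?x i"] le[of i] by simp
  qed
  \<comment> \<open>Only the \<open>b - ?x 0\<close> boxes outside row 0 brought a factor 1 - q, so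
    the exponent remains the size minus the first row.\<close>
  have e3: "(b - ?x 0) + (m - \<mu> 0) = m + b - \<nu> 0" using x0 m le[of 0] by simp
  have "strip_count q (Suc R) m \<mu> ?x * normalizer q (Suc R) m \<mu> =
    qfact q b * ((1 / q) ^ (m * b + (b choose 2)) * (1 / q) ^ (m choose 2))
     * (q ^ (\<Sum>i<Suc R. \<mu> i * ?x i + (?x i choose 2)) * q ^ (\<Sum>i<Suc R. \<mu> i choose 2))
     * ((1 - q) ^ (b - ?x 0) * (1 - q) ^ (m - \<mu> 0))
     / (?F ?x * ?F (\<lambda>i. \<mu> i - \<nu> (Suc i)))"
    using nz[of "\<lambda>i. \<mu> i - \<mu> (Suc i)"]
    unfolding strip_count_def Let_def size rows normalizer_def by (simp add: field_simps)
  also have "\<dots> = qfact q b * (1 / q) ^ ((m + b) choose 2) * q ^ (\<Sum>i<Suc R. \<nu> i choose 2) * (1 - q) ^ (m + b - \<nu> 0)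
     / (?F ?x * ?F (\<lambda>i. \<mu> i - \<nu> (Suc i)))"
    unfolding power_add[symmetric] e1 e2 e3 ..
  also have "\<dots> = qfact q b * strip_weight q (Suc R) \<mu> \<nu> * normalizer q (Suc R) (m + b) \<nu>"
    using nz[of "\<lambda>i. \<nu> i - \<nu> (Suc i)"] unfolding weight normalizer_def by (simp add: field_simps)
  finally show ?thesis .
qed

section \<open>Partial sums of a composition and the block structure of
  \<open>nalpha\<close>\<close>

lemma psum_0 [simp]: "psum \<alpha> 0 = 0"
  by (simp add: psum_def)

lemma psum_length [simp]: "length \<alpha> \<le> j \<Longrightarrow> psum \<alpha> j = sum_list \<alpha>"
  by (simp add: psum_def)

lemma psum_Suc: "j < length \<alpha> \<Longrightarrow> psum \<alpha> (Suc j) = psum \<alpha> j + \<alpha> ! j"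
  by (simp add: psum_def take_Suc_conv_app_nth)

lemma psum_append: "j \<le> length \<alpha> \<Longrightarrow> psum (\<alpha> @ \<beta>) j = psum \<alpha> j"
  by (simp add: psum_def)

lemma psum_mono: "i \<le> j \<Longrightarrow> psum \<alpha> i \<le> psum \<alpha> j"
proof (rule lift_Suc_mono_le[of "psum \<alpha>"])
  show "psum \<alpha> i \<le> psum \<alpha> (Suc i)" for i
    by (cases "i < length \<alpha>") (simp_all add: psum_Suc)
qed

lemma psum_le_sum_list: "psum \<alpha> j \<le> sum_list \<alpha>"
  using psum_mono[of j "max j (length \<alpha>)" \<alpha>] by simp

lemma blk_le_iff:
  assumes "r < sum_list \<alpha>"
  shows "blk \<alpha> r \<le> i \<longleftrightarrow> r < psum \<alpha> i"
proof
  have "r < psum \<alpha> (blk \<alpha> r)"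
    unfolding blk_def by (rule LeastI[of _ "length \<alpha>"]) (simp add: assms)
  then show "r < psum \<alpha> i" if "blk \<alpha> r \<le> i" using psum_mono[OF that, of \<alpha>] by simp
  show "blk \<alpha> r \<le> i" if "r < psum \<alpha> i" unfolding blk_def using that by (rule Least_le)
qed

text \<open>The matrix form of strict compatibility with the flag. For \<open>j\<close> beyond the
  length the partial sums equal \<open>n\<close>, and the condition only concerns rows outside the
  matrix.\<close>

lemma nalpha_iff:
  assumes n: "sum_list \<alpha> = n"
  shows "N \<in> nalpha n \<alpha> \<longleftrightarrow> N \<in> mats n \<and> (\<forall>j r s. psum \<alpha> j \<le> r \<longrightarrow> s < psum \<alpha> (Suc j) \<longrightarrow> N r s = 0)"
proof (intro iffI conjI allI impI)
  assume N: "N \<in> nalpha n \<alpha>"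
  then show "N \<in> mats n" by (simp add: nalpha_def)
  fix j r s assume rs: "psum \<alpha> j \<le> r" "s < psum \<alpha> (Suc j)"
  show "N r s = 0"
  proof (cases "r < n")
    case True
    have "s < n" using rs(2) psum_le_sum_list[of \<alpha> "Suc j"] n by simp
    moreover have "blk \<alpha> s \<le> blk \<alpha> r"
      using rs blk_le_iff[of r \<alpha> j] blk_le_iff[of s \<alpha> "Suc j"] True \<open>s < n\<close> n by simp
    ultimately show ?thesis using N True by (simp add: nalpha_def)
  next
    case False
    then show ?thesis using \<open>N \<in> mats n\<close> by (simp add: mats_def)
  qed
next
  assume N: "N \<in> mats n \<and> (\<forall>j r s. psum \<alpha> j \<le> r \<longrightarrow> s < psum \<alpha> (Suc j) \<longrightarrow> N r s = 0)"
  have "N r s = 0" if rs: "r < n" "s < n" "blk \<alpha> s \<le> blk \<alpha> r" for r s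
  proof -
    \<comment> \<open>Block indices start at 1, as no coordinate lies below
      \<open>psum \<alpha> 0 = 0\<close>.\<close>
    have "blk \<alpha> r \<noteq> 0" using blk_le_iff[of r \<alpha> 0] rs n by simp
    then obtain j where j: "blk \<alpha> r = Suc j" using not0_implies_Suc by blast
    have "psum \<alpha> j \<le> r" using blk_le_iff[of r \<alpha> j] rs n j by simp
    moreover have "s < psum \<alpha> (Suc j)" using blk_le_iff[of s \<alpha> "Suc j"] rs n j by simp
    ultimately show ?thesis using N by blast
  qed
  then show "N \<in> nalpha n \<alpha>" using N by (simp add: nalpha_def)
qed

lemma Eflag_eq: "sum_list \<alpha> = n \<Longrightarrow> Eflag n \<alpha> j = vecs (psum \<alpha> j)"
  using psum_le_sum_list[of \<alpha> j] by (auto simp: Eflag_def vecs_def)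

lemma mapply_nalpha:
  assumes "sum_list \<alpha> = n" "N \<in> nalpha n \<alpha>" "v \<in> vecs (psum \<alpha> (Suc j))"
  shows "mapply n N v \<in> vecs (psum \<alpha> j)"
proof -
  have "N r s * v s = 0" if "psum \<alpha> j \<le> r" for r s
  proof (cases "s < psum \<alpha> (Suc j)")
    case True
    then show ?thesis using assms(2) that unfolding nalpha_iff[OF assms(1)] by auto
  next
    case False
    then show ?thesis using assms(3) by (simp add: vecs_def)
  qed
  then have "(\<Sum>s<n. N r s * v s) = 0" if "psum \<alpha> j \<le> r" for r
    using that by (intro sum.neutral) blast
  then show ?thesis by (simp add: mapply_def vecs_def)
qed

lemma nalpha_nilpotent:
  assumes "sum_list \<alpha> = n" "N \<in> nalpha n \<alpha>" "v \<in> vecs (psum \<alpha> j)"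
  shows "(mapply n N ^^ j) v = 0"
  using assms(3)
proof (induction j arbitrary: v)
  case 0
  then show ?case by (auto simp: vecs_def pointwise)
next
  case (Suc j)
  then show ?case using mapply_nalpha[OF assms(1,2)]
    by (simp add: funpow_Suc_right del: funpow.simps)
qed

text \<open>\<open>M\<close> is the upper left block. Rows of the last block vanish because no
  column lies in a later block; the other rows are free in the last \<open>b\<close>
  columns.\<close>

lemma nalpha_append:
  assumes m: "sum_list \<alpha> = m"
  shows "nalpha (m + b) (\<alpha> @ [b]) = (\<Union>M\<in>nalpha m \<alpha>. colext m b M)"
proof (intro equalityI subsetI)
  have mb: "sum_list (\<alpha> @ [b]) = m + b" using m by simp
  fix N :: "nat \<Rightarrow> nat \<Rightarrow> 'a"
  {
    assume "N \<in> nalpha (m + b) (\<alpha> @ [b])"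
    then have N: "N \<in> mats (m + b)"
      "\<And>j r s. psum (\<alpha> @ [b]) j \<le> r \<Longrightarrow> s < psum (\<alpha> @ [b]) (Suc j) \<Longrightarrow> N r s = 0"
      unfolding nalpha_iff[OF mb] by blast+
    define M where "M = (\<lambda>r s. if r < m \<and> s < m then N r s else 0)"
    have low: "N r s = 0" if "m \<le> r" for r s
    proof (cases "s < m + b")
      case True
      then show ?thesis using N(2)[of "length \<alpha>" r s] that m by (simp add: psum_append)
    next
      case False
      then show ?thesis using N(1) by (simp add: mats_def)
    qed
    have "M r s = 0" if rs: "psum \<alpha> j \<le> r" "s < psum \<alpha> (Suc j)" for j r s
    proof (cases "j < length \<alpha>")
      case True
      then show ?thesis using N(2)[of j r s] rs by (simp add: M_def psum_append)
    next
      case False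
      then show ?thesis using rs m by (simp add: M_def)
    qed
    then have "M \<in> nalpha m \<alpha>" unfolding nalpha_iff[OF m] by (auto simp: M_def mats_def)
    moreover have "N \<in> colext m b M" using N(1) low by (auto simp: colext_def M_def)
    ultimately show "N \<in> (\<Union>M\<in>nalpha m \<alpha>. colext m b M)" by blast
  next
    assume "N \<in> (\<Union>M\<in>nalpha m \<alpha>. colext m b M)"
    then obtain M where M: "M \<in> nalpha m \<alpha>" "N \<in> colext m b M" by blast
    have "N r s = 0" if rs: "psum (\<alpha> @ [b]) j \<le> r" "s < psum (\<alpha> @ [b]) (Suc j)" for j r s
    proof (cases "j < length \<alpha>")
      case True
      then have rs': "psum \<alpha> j \<le> r" "s < psum \<alpha> (Suc j)" using rs by (simp_all add: psum_append)
      then have "s < m" using psum_le_sum_list[of \<alpha> "Suc j"] m by simp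
      then have "N r s = M r s" using M(2) by (simp add: colext_def)
      also have "M r s = 0" using M(1) rs' unfolding nalpha_iff[OF m] by blast
      finally show ?thesis .
    next
      case False
      have "psum (\<alpha> @ [b]) (length \<alpha>) \<le> psum (\<alpha> @ [b]) j"
        using False by (intro psum_mono) simp
      then have "m \<le> r" using rs m by (simp add: psum_append)
      then show ?thesis using M(2) by (simp add: colext_def)
    qed
    then show "N \<in> nalpha (m + b) (\<alpha> @ [b])"
      unfolding nalpha_iff[OF mb] using M(2) by (auto simp: colext_def)
  }
qed

lemma colext_disjoint:
  assumes "M \<in> mats m" "M' \<in> mats m" "M \<noteq> M'"
  shows "colext m b M \<inter> colext m b M' = {}"
proof -
  have "M = M'" if "N \<in> colext m b M" "N \<in> colext m b M'" for N
  proof (intro ext)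
    fix r s show "M r s = M' r s"
      using that assms(1,2) by (cases "s < m") (auto simp: colext_def mats_def)
  qed
  then show ?thesis using assms(3) by blast
qed

lemma finite_nalpha:
  fixes n :: nat
  assumes "sum_list \<alpha> = n"
  shows "finite (nalpha n \<alpha> :: (nat \<Rightarrow> nat \<Rightarrow> 'k::{field,finite}) set)"
  using assms
proof (induction \<alpha> arbitrary: n rule: rev_induct)
  case Nil
  then have "nalpha n [] \<subseteq> {\<lambda>_ _. 0 :: 'k}" by (auto simp: nalpha_def mats_def)
  then show ?case by (rule finite_subset) simp
next
  case (snoc b \<alpha>)
  then have n: "n = sum_list \<alpha> + b" by simp
  show ?case unfolding n nalpha_append[OF refl]
    using snoc.IH[OF refl] finite_colext by (auto simp: nalpha_def)
qed

text \<open>A family of shapes is prescribed instead of a tableau, so that the same \<open>L\<close>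
  serves for every initial segment of \<open>\<alpha>\<close> in the induction on blocks.\<close>

definition chain_set :: "nat list \<Rightarrow> (nat \<Rightarrow> nat \<Rightarrow> nat) \<Rightarrow> (nat \<Rightarrow> nat \<Rightarrow> 'k::field) set" where
  "chain_set \<alpha> L = {N \<in> nalpha (sum_list \<alpha>) \<alpha>.
     \<forall>j\<le>length \<alpha>. JF_on (sum_list \<alpha>) N (vecs (psum \<alpha> j)) = L j}"

text \<open>On the earlier flag members an extension acts as \<open>M\<close> does, so only the
  condition on the whole space is new.\<close>

lemma chain_set_append:
  "chain_set (\<alpha> @ [b]) L = (\<Union>M\<in>chain_set \<alpha> L.
     {N \<in> colext (sum_list \<alpha>) b M. JF (sum_list \<alpha> + b) N = L (Suc (length \<alpha>))})"
proof -
  define m where "m = sum_list \<alpha>"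
  have iff: "(\<forall>j\<le>length (\<alpha> @ [b]). JF_on (m + b) N (vecs (psum (\<alpha> @ [b]) j)) = L j) \<longleftrightarrow>
      (\<forall>j\<le>length \<alpha>. JF_on m M (vecs (psum \<alpha> j)) = L j) \<and> JF (m + b) N = L (Suc (length \<alpha>))"
    if N: "N \<in> colext m b M" for N M :: "nat \<Rightarrow> nat \<Rightarrow> 'a"
  proof -
    have "JF_on (m + b) N (vecs (psum (\<alpha> @ [b]) j)) = JF_on m M (vecs (psum \<alpha> j))" if "j \<le> length \<alpha>" for j
      using JF_on_colext[OF N vecs_mono[OF psum_le_sum_list[of \<alpha> j, folded m_def]]] that
      by (simp add: psum_append)
    moreover have "JF (m + b) N = JF_on (m + b) N (vecs (psum (\<alpha> @ [b]) (Suc (length \<alpha>))))"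
      by (simp add: JF_def m_def)
    ultimately show ?thesis by (auto simp: le_Suc_eq)
  qed
  have eq: "chain_set (\<alpha> @ [b]) L = {N \<in> (\<Union>M\<in>nalpha m \<alpha>. colext m b M).
      \<forall>j\<le>length (\<alpha> @ [b]). JF_on (m + b) N (vecs (psum (\<alpha> @ [b]) j)) = L j}"
    unfolding chain_set_def m_def nalpha_append[OF refl, symmetric] by simp
  have chain: "M \<in> chain_set \<alpha> L \<longleftrightarrow> M \<in> nalpha m \<alpha> \<and>
      (\<forall>j\<le>length \<alpha>. JF_on m M (vecs (psum \<alpha> j)) = L j)" for M :: "nat \<Rightarrow> nat \<Rightarrow> 'a"
    unfolding chain_set_def m_def by blast
  show ?thesis unfolding eq m_def[symmetric]
  proof (intro equalityI subsetI)
    fix N :: "nat \<Rightarrow> nat \<Rightarrow> 'a"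
    assume "N \<in> {N \<in> (\<Union>M\<in>nalpha m \<alpha>. colext m b M).
      \<forall>j\<le>length (\<alpha> @ [b]). JF_on (m + b) N (vecs (psum (\<alpha> @ [b]) j)) = L j}"
    then obtain M where M: "M \<in> nalpha m \<alpha>" "N \<in> colext m b M"
      and "\<forall>j\<le>length (\<alpha> @ [b]). JF_on (m + b) N (vecs (psum (\<alpha> @ [b]) j)) = L j" by blast
    then show "N \<in> (\<Union>M\<in>chain_set \<alpha> L. {N \<in> colext m b M. JF (m + b) N = L (Suc (length \<alpha>))})"
      unfolding iff[OF M(2)] using chain by blast
  next
    fix N :: "nat \<Rightarrow> nat \<Rightarrow> 'a"
    assume "N \<in> (\<Union>M\<in>chain_set \<alpha> L. {N \<in> colext m b M. JF (m + b) N = L (Suc (length \<alpha>))})"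
    then obtain M where M: "M \<in> chain_set \<alpha> L" "N \<in> colext m b M" "JF (m + b) N = L (Suc (length \<alpha>))"
      by blast
    then show "N \<in> {N \<in> (\<Union>M\<in>nalpha m \<alpha>. colext m b M).
      \<forall>j\<le>length (\<alpha> @ [b]). JF_on (m + b) N (vecs (psum (\<alpha> @ [b]) j)) = L j}"
      using iff[OF M(2)] chain by blast
  qed
qed

text \<open>All matrices of the shorter chain have equally many extensions. The normalizers
  telescope, and only the last one is left because that of the empty shape is 1. A common bound
  \<open>R\<close> on the rows gives all products the same range.\<close>

lemma card_chain_set:
  fixes q :: real
  assumes q: "q = 1 / real CARD('k::{field,finite})"
    and L0: "\<And>i. L 0 i = 0"
    and mono: "\<And>j i. j < length \<alpha> \<Longrightarrow> L j i \<le> L (Suc j) i"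
    and strip: "\<And>j i. j < length \<alpha> \<Longrightarrow> L (Suc j) (Suc i) \<le> L j i"
    and supp: "\<And>j i. j \<le> length \<alpha> \<Longrightarrow> i > R \<Longrightarrow> L j i = 0"
    and size: "\<And>j. j \<le> length \<alpha> \<Longrightarrow> (\<Sum>i<Suc R. L j i) = psum \<alpha> j"
  shows "real (card (chain_set \<alpha> L :: (nat \<Rightarrow> nat \<Rightarrow> 'k) set)) =
    (\<Prod>j<length \<alpha>. qfact q (\<alpha> ! j) * strip_weight q (Suc R) (L j) (L (Suc j)))
     * normalizer q (Suc R) (sum_list \<alpha>) (L (length \<alpha>))"
  using mono strip supp size
proof (induction \<alpha> rule: rev_induct)
  case Nil
  have "L 0 = JF_on 0 N (vecs 0)" for N :: "nat \<Rightarrow> nat \<Rightarrow> 'k"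
  proof
    fix i
    have "{v \<in> vecs 0. (mapply 0 N ^^ t) v = 0} = {0}" for t
      by (auto simp: vecs_def pointwise[symmetric] mapply_pow_zero simp del: funpow.simps)
        (auto simp: zero_fun_def mapply_pow_zero[unfolded zero_fun_def])
    then show "L 0 i = JF_on 0 N (vecs 0) i" by (simp add: JF_on_def L0 del: funpow.simps)
  qed
  moreover have "nalpha 0 [] = {\<lambda>_ _. 0 :: 'k}" by (auto simp: nalpha_def mats_def)
  ultimately have "chain_set [] L = {\<lambda>_ _. 0 :: 'k}" by (auto simp: chain_set_def)
  then show ?case by (simp add: normalizer_def L0 binomial_eq_0)
next
  case (snoc b \<alpha>)
  define m where "m = sum_list \<alpha>"
  define k where "k = length \<alpha>"
  let ?C = "chain_set \<alpha> L :: (nat \<Rightarrow> nat \<Rightarrow> 'k) set"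
  let ?E = "\<lambda>M. {N \<in> colext m b M. JF (m + b) N = L (Suc k)}"
  let ?x = "\<lambda>i. L (Suc k) i - L k i"
  have q0: "q > 0" using q by simp
  have le: "L k i \<le> L (Suc k) i" and strip_k: "L (Suc k) (Suc i) \<le> L k i" for i
    using snoc.prems(1,2)[of k] by (auto simp: k_def)
  have zero: "L k i = 0" "L (Suc k) i = 0" if "i > R" for i
    using snoc.prems(3)[OF _ that, of k] snoc.prems(3)[OF _ that, of "Suc k"] by (simp_all add: k_def)
  have size_k: "(\<Sum>i<Suc R. L k i) = m" "(\<Sum>i<Suc R. L (Suc k) i) = m + b"
    using snoc.prems(4)[of k] snoc.prems(4)[of "Suc k"] by (simp_all add: k_def m_def psum_append)
  have size_x: "(\<Sum>i<Suc R. ?x i) = b"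
    using sum_subtractf_nat[of "{..<Suc R}" "L k" "L (Suc k)"] le size_k by simp
  have L_k0: "L k 0 \<le> m" using member_le_sum[of 0 "{..<Suc R}" "L k"] size_k by simp
  have mats: "M \<in> mats m" and nalpha: "M \<in> nalpha m \<alpha>" and JF_M: "JF m M = L k" if "M \<in> ?C" for M
    using that by (auto simp: chain_set_def nalpha_def m_def k_def JF_def)
  have finC: "finite ?C" using finite_nalpha[of \<alpha> m] by (auto simp: chain_set_def m_def)
  have fibre: "real (card (?E M)) = strip_count q (Suc R) m (L k) ?x" if M: "M \<in> ?C" for M
  proof -
    have "(\<lambda>i. L k i + ?x i) = L (Suc k)" using le by (simp add: fun_eq_iff)
    moreover have "real (card {N \<in> colext m b M. JF (m + b) N = (\<lambda>i. L k i + ?x i)}) = strip_count q (Suc R) m (L k) ?x"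
    proof (rule card_colext_JF[OF q mats[OF M] _ JF_M[OF M]])
      show "(mapply m M ^^ k) v = 0" if "v \<in> vecs m" for v
        using nalpha_nilpotent[OF _ nalpha[OF M], of v k] that by (simp add: m_def k_def)
      show "L k (Suc i) + (L (Suc k) (Suc i) - L k (Suc i)) \<le> L k i" for i
        using strip_k[of i] le[of "Suc i"] by simp
      show "?x i = 0" if "Suc R \<le> i" for i using zero[of i] that by simp
    qed (rule size_x)
    ultimately show ?thesis by simp
  qed
  have "card (\<Union>M\<in>?C. ?E M) = (\<Sum>M\<in>?C. card (?E M))"
  proof (rule card_UN_disjoint[OF finC])
    show "\<forall>M\<in>?C. finite (?E M)" using finite_colext[OF mats] by simp
    show "\<forall>M\<in>?C. \<forall>M'\<in>?C. M \<noteq> M' \<longrightarrow> ?E M \<inter> ?E M' = {}"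
      using colext_disjoint[OF mats mats] by blast
  qed
  then have "real (card (chain_set (\<alpha> @ [b]) L :: (nat \<Rightarrow> nat \<Rightarrow> 'k) set)) = (\<Sum>M\<in>?C. real (card (?E M)))"
    unfolding chain_set_append m_def k_def by (simp only: of_nat_sum)
  also have "\<dots> = real (card ?C) * strip_count q (Suc R) m (L k) ?x"
    by (simp only: sum.cong[OF refl fibre] sum_constant)
  also have "real (card ?C) = (\<Prod>j<k. qfact q (\<alpha> ! j) * strip_weight q (Suc R) (L j) (L (Suc j)))
     * normalizer q (Suc R) m (L k)"
    unfolding m_def k_def
  proof (rule snoc.IH)
    fix j i
    show "L j i \<le> L (Suc j) i" "L (Suc j) (Suc i) \<le> L j i" if "j < length \<alpha>"
      using snoc.prems(1,2)[of j] that by simp_all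
    show "L j i = 0" if "j \<le> length \<alpha>" "R < i" using snoc.prems(3)[of j i] that by simp
    show "(\<Sum>i<Suc R. L j i) = psum \<alpha> j" if "j \<le> length \<alpha>"
      using snoc.prems(4)[of j] that by (simp add: psum_append)
  qed
  \<comment> \<open>Regrouped so that the normalizer of \<open>L k\<close> from the induction
    hypothesis meets the strip count starting at \<open>L k\<close>.\<close>
  also have "\<dots> * strip_count q (Suc R) m (L k) ?x =
    (\<Prod>j<k. qfact q (\<alpha> ! j) * strip_weight q (Suc R) (L j) (L (Suc j)))
     * (strip_count q (Suc R) m (L k) ?x * normalizer q (Suc R) m (L k))"
    by simp
  also have "strip_count q (Suc R) m (L k) ?x * normalizer q (Suc R) m (L k)
    = qfact q b * strip_weight q (Suc R) (L k) (L (Suc k)) * normalizer q (Suc R) (m + b) (L (Suc k))"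
    by (rule strip_count_normalizer[OF q0 le strip_k _ size_x L_k0]) (simp add: zero)
  finally show ?case by (simp add: k_def m_def nth_append mult.assoc)
qed

section \<open>Tableaux\<close>

lemma sum_card_rows:
  fixes T :: "nat \<times> nat \<Rightarrow> nat"
  assumes "\<And>r c. P (T (r, c)) \<Longrightarrow> r < t \<and> c < u"
  shows "(\<Sum>r<t. card {c. P (T (r, c))}) = card {x. P (T x)}"
proof -
  have fin: "finite {c. P (T (r, c))}" for r
    by (rule finite_subset[of _ "{..<u}"]) (use assms in auto)
  have "{x. P (T x)} = Sigma {..<t} (\<lambda>r. {c. P (T (r, c))})" using assms by auto
  then show ?thesis using fin by (simp add: card_SigmaI)
qed

lemma tshape_0 [simp]: "tshape T 0 r = 0"
proof -
  have "{c. 1 \<le> T (r, c) \<and> T (r, c) \<le> 0} = {}" by auto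
  then show ?thesis unfolding tshape_def by (simp only: card.empty)
qed

lemma tshape_Suc:
  assumes "\<And>c. T (r, c) \<noteq> 0 \<Longrightarrow> c < u"
  shows "tshape T (Suc j) r = tshape T j r + card {c. T (r, c) = Suc j}"
proof -
  have "{c. 1 \<le> T (r, c) \<and> T (r, c) \<le> Suc j} = {c. 1 \<le> T (r, c) \<and> T (r, c) \<le> j} \<union> {c. T (r, c) = Suc j}"
    by auto
  moreover have "finite {c. T (r, c) \<noteq> 0}"
    by (rule finite_subset[of _ "{..<u}"]) (use assms in auto)
  then have "finite {c. 1 \<le> T (r, c) \<and> T (r, c) \<le> j}" "finite {c. T (r, c) = Suc j}"
    by (rule finite_subset[rotated], force)+
  ultimately show ?thesis unfolding tshape_def by (simp add: card_Un_disjoint disjoint_iff)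
qed

lemma sum_tshape_Suc:
  assumes supp: "\<And>r c. T (r, c) \<noteq> 0 \<Longrightarrow> r < t \<and> c < u"
  shows "(\<Sum>r<t. tshape T (Suc j) r) = (\<Sum>r<t. tshape T j r) + card {x. T x = Suc j}"
proof -
  have "tshape T (Suc j) r = tshape T j r + card {c. T (r, c) = Suc j}" for r
    by (rule tshape_Suc[where u = u]) (use supp in blast)
  moreover have "(\<Sum>r<t. card {c. T (r, c) = Suc j}) = card {x. T x = Suc j}"
    by (rule sum_card_rows[where u = u]) (rule supp, simp)
  ultimately show ?thesis by (simp add: sum.distrib)
qed

lemma sum_tshape:
  assumes supp: "\<And>r c. T (r, c) \<noteq> 0 \<Longrightarrow> r < t \<and> c < u"
    and content: "\<And>j. j < length \<alpha> \<Longrightarrow> card {x. T x = Suc j} = \<alpha> ! j"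
    and "j \<le> length \<alpha>"
  shows "(\<Sum>r<t. tshape T j r) = psum \<alpha> j"
  using assms(3)
proof (induction j)
  case 0
  then show ?case by simp
next
  case (Suc j)
  then show ?case using content by (simp add: sum_tshape_Suc[OF supp] psum_Suc)
qed

lemma down_closed_eq_lessThan:
  fixes A :: "nat set"
  assumes "finite A" "\<And>a b. b \<in> A \<Longrightarrow> a \<le> b \<Longrightarrow> a \<in> A"
  shows "A = {..<card A}"
proof -
  obtain m where m: "m \<notin> A" "\<And>i. i < m \<Longrightarrow> i \<in> A"
    using exists_least_iff[of "\<lambda>i. i \<notin> A"] assms(1) ex_new_if_finite[OF infinite_UNIV_nat]
    by blast
  have "A = {..<m}" using m assms(2) by (auto simp: not_less[symmetric])
  then show ?thesis by (metis card_lessThan)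
qed

lemma partition_antimono: "is_partition n lam \<Longrightarrow> i \<le> j \<Longrightarrow> lam j \<le> lam i"
  by (rule lift_Suc_antimono_le) (simp_all add: is_partition_def)

lemma partition_le_size:
  assumes "is_partition n lam" shows "lam i \<le> n"
proof (cases "i < n")
  case True
  then show ?thesis
    using assms member_le_sum[of i "{..<n}" lam] by (simp add: is_partition_def)
qed (use assms in \<open>simp add: is_partition_def\<close>)

context
  fixes n lam \<alpha> T
  assumes lam: "is_partition n lam" and ssyt: "is_ssyt lam \<alpha> T" and size: "sum_list \<alpha> = n"
begin

lemma ssyt_nonzero_iff: "T (r, c) \<noteq> 0 \<longleftrightarrow> c < lam r"
  using ssyt by (simp add: is_ssyt_def)

lemma ssyt_support: "T (r, c) \<noteq> 0 \<Longrightarrow> r < n \<and> c < n"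
  using partition_le_size[OF lam, of r] lam ssyt_nonzero_iff
  by (metis is_partition_def less_le_trans not_less not_less_zero)

text \<open>A larger entry would have multiplicity 0 although its fibre is nonempty. The support
  bound is needed because \<open>card\<close> is 0 on infinite sets too.\<close>

lemma ssyt_le_length: "T x \<le> length \<alpha>"
proof (rule ccontr)
  assume "\<not> T x \<le> length \<alpha>"
  then have "card {y. T y = T x} = 0" using ssyt by (simp add: is_ssyt_def)
  moreover have "{y. T y = T x} \<subseteq> {..<n} \<times> {..<n}"
  proof
    fix y assume "y \<in> {y. T y = T x}"
    then have "T (fst y, snd y) \<noteq> 0" using \<open>\<not> T x \<le> length \<alpha>\<close> by simp
    from ssyt_support[OF this] show "y \<in> {..<n} \<times> {..<n}" by (simp add: mem_Times_iff)
  qed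
  then have "finite {y. T y = T x}" by (rule finite_subset) simp
  ultimately have "{y. T y = T x} = {}" by simp
  then show False by blast
qed

lemma ssyt_content: "j < length \<alpha> \<Longrightarrow> card {x. T x = Suc j} = \<alpha> ! j"
  using ssyt by (simp add: is_ssyt_def)

lemma ssyt_row_mono:
  assumes "c \<le> c'" "c' < lam r" shows "T (r, c) \<le> T (r, c')"
  using assms
proof (induction c' rule: dec_induct)
  case (step c')
  then have "T (r, c') \<le> T (r, Suc c')" using ssyt by (simp add: is_ssyt_def)
  then show ?case using step by simp
qed simp

text \<open>Rows increase weakly, so the cells with entries up to \<open>j\<close> form an initial
  segment of the row, described by its cardinality.\<close>

lemma ssyt_less_tshape_iff: "c < tshape T j r \<longleftrightarrow> c < lam r \<and> T (r, c) \<le> j"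
proof -
  let ?A = "{c. 1 \<le> T (r, c) \<and> T (r, c) \<le> j}"
  have A: "?A = {c. c < lam r \<and> T (r, c) \<le> j}" using ssyt_nonzero_iff by (auto simp: Suc_le_eq)
  have "?A = {..<card ?A}"
    unfolding A by (rule down_closed_eq_lessThan) (use ssyt_row_mono order_trans in fastforce)+
  then have "c \<in> ?A \<longleftrightarrow> c < tshape T j r" unfolding tshape_def by blast
  then show ?thesis unfolding A by simp
qed

lemma tshape_mono: "i \<le> j \<Longrightarrow> tshape T i r \<le> tshape T j r"
  using ssyt_less_tshape_iff[of _ i r] ssyt_less_tshape_iff[of _ j r]
  by (meson le_trans not_less order_refl)

text \<open>Otherwise the column with index \<open>tshape T j r\<close> has an entry at most
  \<open>j + 1\<close> in row \<open>r + 1\<close>, hence at most \<open>j\<close> above it,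
  although row \<open>r\<close> of the smaller shape stops before that column.\<close>

lemma tshape_strip: "tshape T (Suc j) (Suc r) \<le> tshape T j r"
proof (rule ccontr)
  assume "\<not> tshape T (Suc j) (Suc r) \<le> tshape T j r"
  then have "tshape T j r < tshape T (Suc j) (Suc r)" by simp
  then have c: "tshape T j r < lam (Suc r)" "T (Suc r, tshape T j r) \<le> Suc j"
    using ssyt_less_tshape_iff by auto
  then have "T (r, tshape T j r) < T (Suc r, tshape T j r)" using ssyt by (simp add: is_ssyt_def)
  moreover have "tshape T j r < lam r" using c(1) partition_antimono[OF lam, of r "Suc r"] by simp
  ultimately show False using ssyt_less_tshape_iff[of "tshape T j r" j r] c(2) by simp
qed

lemma tshape_length: "tshape T (length \<alpha>) = lam"
  using ssyt_less_tshape_iff[of _ "length \<alpha>"] ssyt_le_length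
  by (metis (no_types, lifting) ext linorder_neqE_nat order_less_irrefl)

lemma tshape_beyond: "n \<le> r \<Longrightarrow> tshape T j r = 0"
  using ssyt_less_tshape_iff[of 0 j r] lam by (simp add: is_partition_def)

lemma sum_tshape_ssyt:
  assumes "j \<le> length \<alpha>" "n \<le> t" shows "(\<Sum>r<t. tshape T j r) = psum \<alpha> j"
  by (rule sum_tshape[where u = n]) (use assms ssyt_support ssyt_content in fastforce)+

text \<open>\<open>wt\<close> stops at the largest entry and at the number of cells, here the ranges
  are \<open>length \<alpha>\<close> and \<open>Suc n\<close>. The additional factors are
  q-binomials with lower index 0.\<close>

lemma wt_ssyt:
  assumes q: "q > 0"
  shows "wt q T = (\<Prod>j<length \<alpha>. strip_weight q (Suc n) (tshape T j) (tshape T (Suc j)))"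
proof -
  have qbinom_0: "qbinom q m 0 = 1" for m using qfact_pos[OF q, of m] by (simp add: qbinom_def)
  have "card {x. T x \<noteq> 0} = (\<Sum>r<n. card {c. T (r, c) \<noteq> 0})"
    by (rule sum_card_rows[symmetric, where u = n]) (use ssyt_support in auto)
  also have "\<dots> = n" using lam unfolding ssyt_nonzero_iff by (simp add: is_partition_def)
  finally have cells: "card {x. T x \<noteq> 0} = n" .
  have fin: "finite (range T)" by (rule finite_subset[of _ "{..length \<alpha>}"]) (auto simp: ssyt_le_length)
  have "(\<Prod>j\<in>{1..Max (range T)}. strip_weight q (Suc n) (tshape T (j - 1)) (tshape T j))
    = (\<Prod>j\<in>{1..length \<alpha>}. strip_weight q (Suc n) (tshape T (j - 1)) (tshape T j))"
  proof (rule prod.mono_neutral_left)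
    show "{1..Max (range T)} \<subseteq> {1..length \<alpha>}"
      using fin by (auto simp: ssyt_le_length intro: order_trans)
    show "\<forall>j\<in>{1..length \<alpha>} - {1..Max (range T)}. strip_weight q (Suc n) (tshape T (j - 1)) (tshape T j) = 1"
    proof
      fix j assume j: "j \<in> {1..length \<alpha>} - {1..Max (range T)}"
      then have "T x \<le> j - 1" for x using Max_ge[OF fin, of "T x"] by fastforce
      then have "T x \<le> j \<longleftrightarrow> T x \<le> j - 1" for x by (meson diff_le_self le_trans)
      then have "tshape T j = tshape T (j - 1)" by (simp add: tshape_def fun_eq_iff)
      then show "strip_weight q (Suc n) (tshape T (j - 1)) (tshape T j) = 1"
        by (simp add: strip_weight_def qbinom_0)
    qed
  qed simp
  also have "\<dots> = (\<Prod>j<length \<alpha>. strip_weight q (Suc n) (tshape T j) (tshape T (Suc j)))"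
    using prod.atLeast1_atMost_eq[of "\<lambda>j. strip_weight q (Suc n) (tshape T (j - 1)) (tshape T j)"] by simp
  finally show ?thesis
    unfolding wt_def cells by (simp add: strip_weight_def tshape_beyond qbinom_0 atLeast0LessThan)
qed

end

lemma finite_ssyt:
  assumes "is_partition n lam" "sum_list \<alpha> = n"
  shows "finite {T. is_ssyt lam \<alpha> T}"
proof (rule finite_subset)
  show "{T. is_ssyt lam \<alpha> T} \<subseteq>
    {T. \<forall>x. (x \<in> {..<n} \<times> {..<n} \<longrightarrow> T x \<in> {..length \<alpha>}) \<and> (x \<notin> {..<n} \<times> {..<n} \<longrightarrow> T x = 0)}"
    using ssyt_le_length[OF assms(1) _ assms(2)] ssyt_support[OF assms(1) _ assms(2)] by fastforce
qed (rule finite_set_of_finite_funs; simp)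

section \<open>The tableau of a matrix and its flag\<close>

context
  fixes n \<alpha> and N :: "nat \<Rightarrow> nat \<Rightarrow> 'k::{field,finite}" and L :: "nat \<Rightarrow> nat \<Rightarrow> nat"
  assumes size: "sum_list \<alpha> = n" and N: "N \<in> nalpha n \<alpha>"
  defines "L \<equiv> \<lambda>j. JF_on n N (vecs (psum \<alpha> j))"
begin

lemma JF_eq_flag_JF: "length \<alpha> \<le> j \<Longrightarrow> JF n N = L j"
  by (simp add: JF_def L_def size)

lemma flag_JF_mono: "i \<le> j \<Longrightarrow> L i r \<le> L j r"
  unfolding L_def by (intro JF_on_mono subspace_vecs finite_vecs vecs_mono psum_mono)

lemma flag_JF_le_JF: "L j r \<le> JF n N r"
  using flag_JF_mono[of j "max j (length \<alpha>)" r] JF_eq_flag_JF[of "max j (length \<alpha>)"] by simp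

lemma flag_JF_strip: "L (Suc j) (Suc r) \<le> L j r"
  unfolding L_def using mapply_nalpha[OF size N]
  by (intro JF_on_Suc_le subspace_vecs finite_vecs) auto

text \<open>\<open>N^j\<close> kills flag member \<open>j\<close>, so the first \<open>t\<close>
  rows already account for its whole dimension.\<close>

lemma sum_flag_JF:
  assumes "j \<le> t" shows "(\<Sum>r<t. L j r) = psum \<alpha> j"
proof -
  have "(mapply n N ^^ t) v = 0" if "v \<in> vecs (psum \<alpha> j)" for v
    using mapply_pow_kernel_mono[OF nalpha_nilpotent[OF size N that] assms] .
  then show ?thesis
    unfolding L_def by (simp add: sum_JF_on_nilpotent subspace_vecs finite_vecs vdim_vecs)
qed

lemma flag_JF_0: "L 0 r = 0"
  using sum_flag_JF[of 0 "Suc r"] by simp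

lemma flag_JF_beyond: "j \<le> r \<Longrightarrow> L j r = 0"
  using sum_flag_JF[of j r] sum_flag_JF[of j "Suc r"] by simp

lemma JF_flag_eq:
  "JF_flag n \<alpha> N (r, c) = (if c < JF n N r then (LEAST i. c < L i r) else 0)"
  by (simp add: JF_flag_def Eflag_eq[OF size] JF_def L_def size)

text \<open>The shapes \<open>L j\<close> increase with \<open>j\<close>, so the least index is a
  threshold; it exists because \<open>L (length \<alpha>)\<close> is the full shape.\<close>

lemma JF_flag_le_iff:
  assumes "c < JF n N r" shows "JF_flag n \<alpha> N (r, c) \<le> j \<longleftrightarrow> c < L j r"
proof -
  have eq: "JF_flag n \<alpha> N (r, c) = (LEAST i. c < L i r)" using assms by (simp add: JF_flag_eq)
  have "c < L (length \<alpha>) r" using assms JF_eq_flag_JF[of "length \<alpha>"] by simp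
  then have "c < L (JF_flag n \<alpha> N (r, c)) r" unfolding eq by (rule LeastI)
  then show ?thesis
    using flag_JF_mono[of "JF_flag n \<alpha> N (r, c)" j r] Least_le[of "\<lambda>i. c < L i r" j] eq
    by (metis less_le_trans)
qed

lemma JF_flag_nonzero_iff: "JF_flag n \<alpha> N (r, c) \<noteq> 0 \<longleftrightarrow> c < JF n N r"
  using JF_flag_le_iff[of c r 0] by (auto simp: flag_JF_0 JF_flag_eq)

lemma tshape_JF_flag: "tshape (JF_flag n \<alpha> N) j r = L j r"
proof -
  have "1 \<le> JF_flag n \<alpha> N (r, c) \<and> JF_flag n \<alpha> N (r, c) \<le> j \<longleftrightarrow> c < L j r" for c
  proof (cases "c < JF n N r")
    case True
    then have "1 \<le> JF_flag n \<alpha> N (r, c)" using JF_flag_nonzero_iff[of r c] by simp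
    then show ?thesis using JF_flag_le_iff[OF True] by simp
  next
    case False
    then show ?thesis using JF_flag_nonzero_iff[of r c] flag_JF_le_JF[of j r] by auto
  qed
  then show ?thesis by (simp add: tshape_def)
qed

text \<open>Rows increase since each shape contains the left neighbours of its cells; columns
  increase strictly because \<open>N\<close> lowers the flag by one step; the content comes from the
  sizes of consecutive shapes.\<close>

lemma ssyt_JF_flag: "is_ssyt (JF n N) \<alpha> (JF_flag n \<alpha> N)"
  unfolding is_ssyt_def
proof (intro conjI allI impI)
  let ?T = "JF_flag n \<alpha> N"
  fix r c v
  show "?T (r, c) \<noteq> 0 \<longleftrightarrow> c < JF n N r" by (rule JF_flag_nonzero_iff)
  show "?T (r, c) \<le> ?T (r, Suc c)" if "Suc c < JF n N r"
    using JF_flag_le_iff[of "Suc c" r "?T (r, Suc c)"] JF_flag_le_iff[of c r "?T (r, Suc c)"] that by simp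
  show "?T (r, c) < ?T (Suc r, c)" if c: "c < JF n N (Suc r)"
  proof -
    have "?T (Suc r, c) \<noteq> 0" using c JF_flag_nonzero_iff by simp
    then obtain j where j: "?T (Suc r, c) = Suc j" using not0_implies_Suc by blast
    then have "c < L j r" using JF_flag_le_iff[OF c, of "Suc j"] flag_JF_strip[of j r] by simp
    then show ?thesis using JF_flag_le_iff[of c r j] flag_JF_le_JF[of j r] j by simp
  qed
  show "card {x. ?T x = v} = (if v \<le> length \<alpha> then \<alpha> ! (v - 1) else 0)" if v1: "1 \<le> v"
  proof -
    obtain j where v: "v = Suc j" using v1 by (cases v) auto
    \<comment> \<open>At least \<open>Suc j\<close> and beyond all nonzero rows, so both row sums up
      to \<open>t\<close> are partial sums of \<open>\<alpha>\<close>. These coincide once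
      \<open>j\<close> reaches the length, which gives multiplicity 0.\<close>
    define t where "t = Suc (max j (length \<alpha>))"
    have "JF n N r = 0" if "t \<le> r" for r
      using flag_JF_beyond[of "length \<alpha>" r] JF_eq_flag_JF[of "length \<alpha>"] that by (simp add: t_def)
    then have supp_t: "r < t" if "?T (r, c) \<noteq> 0" for r c
      using that JF_flag_nonzero_iff[of r c] by (metis not_less not_less_zero)
    have supp: "r < t \<and> c < n" if "?T (r, c) \<noteq> 0" for r c
    proof -
      have "c < L (length \<alpha>) r" using that JF_flag_nonzero_iff[of r c] JF_eq_flag_JF[of "length \<alpha>"] by simp
      also have "\<dots> \<le> n"
        using sum_flag_JF[of "length \<alpha>" t] member_le_sum[of r "{..<t}" "L (length \<alpha>)"] supp_t[OF that]
        by (simp add: t_def size)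
      finally show ?thesis using supp_t[OF that] by simp
    qed
    have "psum \<alpha> (Suc j) = psum \<alpha> j + card {x. ?T x = Suc j}"
      using sum_tshape_Suc[of ?T t n j, OF supp] by (simp add: tshape_JF_flag sum_flag_JF t_def del: sum.lessThan_Suc)
    then show ?thesis unfolding v by (cases "j < length \<alpha>") (simp_all add: psum_Suc)
  qed
qed

end

lemma JF_flag_eq_iff_chain_set:
  fixes N :: "nat \<Rightarrow> nat \<Rightarrow> 'k::{field,finite}"
  assumes lam: "is_partition n lam" and T: "is_ssyt lam \<alpha> T" and size: "sum_list \<alpha> = n"
  shows "N \<in> nalpha n \<alpha> \<and> JF_flag n \<alpha> N = T \<longleftrightarrow> N \<in> chain_set \<alpha> (tshape T)"
proof (intro iffI)
  assume N: "N \<in> nalpha n \<alpha> \<and> JF_flag n \<alpha> N = T"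
  have "JF_on n N (vecs (psum \<alpha> j)) = tshape T j" for j
    using tshape_JF_flag[OF size, of N j] N by (intro ext) auto
  then show "N \<in> chain_set \<alpha> (tshape T)" using N by (simp add: chain_set_def size)
next
  assume "N \<in> chain_set \<alpha> (tshape T)"
  then have N: "N \<in> nalpha n \<alpha>"
    and eq: "\<And>j. j \<le> length \<alpha> \<Longrightarrow> JF_on n N (vecs (psum \<alpha> j)) = tshape T j"
    by (auto simp: chain_set_def size)
  have JF: "JF n N = lam"
    using JF_eq_flag_JF[OF size N, of "length \<alpha>"] eq[of "length \<alpha>"] tshape_length[OF lam T size] by simp
  have "JF_flag n \<alpha> N (r, c) = T (r, c)" for r c
  proof (cases "c < lam r")
    case True
    have "JF_flag n \<alpha> N (r, c) \<le> j \<longleftrightarrow> T (r, c) \<le> j" if "j \<le> length \<alpha>" for j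
      using JF_flag_le_iff[OF size N, of c r j] ssyt_less_tshape_iff[OF lam T size, of c j r] True JF eq[OF that]
      by simp
    \<comment> \<open>Thresholds agree only up to \<open>length \<alpha>\<close>. The third instance
      bounds the entry of \<open>JF_flag\<close>, which makes the second available; the first two
      give the two inequalities.\<close>
    from this[of "T (r, c)"] this[of "JF_flag n \<alpha> N (r, c)"] this[of "length \<alpha>"]
    show ?thesis using ssyt_le_length[OF lam T size, of "(r, c)"] by simp
  next
    case False
    then show ?thesis
      using JF_flag_nonzero_iff[OF size N, of r c] ssyt_nonzero_iff[OF lam T size, of r c] JF by simp
  qed
  then show "N \<in> nalpha n \<alpha> \<and> JF_flag n \<alpha> N = T" using N by (auto simp: fun_eq_iff)
qed

lemma card_JF_flag:
  fixes q :: real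
  assumes q: "q = 1 / real CARD('k::{field,finite})"
    and lam: "is_partition n lam" and T: "is_ssyt lam \<alpha> T" and size: "sum_list \<alpha> = n"
  shows "real (card {N :: nat \<Rightarrow> nat \<Rightarrow> 'k. N \<in> nalpha n \<alpha> \<and> JF_flag n \<alpha> N = T})
    = (\<Prod>j<length \<alpha>. qfact q (\<alpha> ! j)) * wt q T * normalizer q (Suc n) n lam"
proof -
  have q0: "q > 0" using q by simp
  have "real (card (chain_set \<alpha> (tshape T) :: (nat \<Rightarrow> nat \<Rightarrow> 'k) set)) =
    (\<Prod>j<length \<alpha>. qfact q (\<alpha> ! j) * strip_weight q (Suc n) (tshape T j) (tshape T (Suc j)))
     * normalizer q (Suc n) (sum_list \<alpha>) (tshape T (length \<alpha>))"
    using tshape_mono[OF lam T size] tshape_strip[OF lam T size]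
      tshape_beyond[OF lam T size] sum_tshape_ssyt[OF lam T size]
    by (intro card_chain_set[OF q]) simp_all
  then show ?thesis
    unfolding JF_flag_eq_iff_chain_set[OF lam T size] wt_ssyt[OF lam T size q0]
    by (simp add: prod.distrib size tshape_length[OF lam T size])
qed

theorem theorem5p12:
  fixes n :: nat and lam :: "nat \<Rightarrow> nat" and \<alpha> :: "nat list" and q :: real
  assumes "\<exists>p e. prime (p::nat) \<and> e \<ge> 1 \<and> card (UNIV :: 'k set) = p ^ e"
    and "q = 1 / real (card (UNIV :: 'k set))"
    and "is_partition n lam"
    and "is_weak_comp n \<alpha>"
  shows "(\<forall>T. is_ssyt lam \<alpha> T \<longrightarrow>
            wt q T = q powi (int (n choose 2) - int (npart n lam)) * (1 - q) powi (int (lam 0) - int n)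
                     * (\<Prod>i<n. qfact q (lam i - lam (Suc i))) / (\<Prod>i<length \<alpha>. qfact q (\<alpha> ! i))
                     * real (card {N::nat \<Rightarrow> nat \<Rightarrow> 'k::{field,finite}. N \<in> nalpha n \<alpha> \<and> JF_flag n \<alpha> N = T}))
       \<and> W_coeff q lam \<alpha> = q powi (int (n choose 2) - int (npart n lam)) * (1 - q) powi (int (lam 0) - int n)
                     * (\<Prod>i<n. qfact q (lam i - lam (Suc i))) / (\<Prod>i<length \<alpha>. qfact q (\<alpha> ! i))
                     * real (card {N::nat \<Rightarrow> nat \<Rightarrow> 'k::{field,finite}. N \<in> nalpha n \<alpha> \<and> JF n N = lam})"
proof -
  note q = assms(2) and lam = assms(3)
  have size: "sum_list \<alpha> = n" using assms(4) by (simp add: is_weak_comp_def)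
  have q0: "q > 0" and q1: "q < 1"
    using q CARD_field_gt_1[where 'k = 'k] by simp_all
  let ?A = "\<Prod>i<length \<alpha>. qfact q (\<alpha> ! i)"
  let ?P = "\<Prod>i<n. qfact q (lam i - lam (Suc i))"
  define c where "c = q powi (int (n choose 2) - int (npart n lam)) * (1 - q) powi (int (lam 0) - int n)
     * ?P / ?A"
  let ?M = "\<lambda>T. {N :: nat \<Rightarrow> nat \<Rightarrow> 'k. N \<in> nalpha n \<alpha> \<and> JF_flag n \<alpha> N = T}"
  have A: "?A > 0" and P: "?P > 0" by (intro prod_pos ballI qfact_pos[OF q0])+
  have lam_n: "lam n = 0" "lam (Suc n) = 0" using lam by (simp_all add: is_partition_def)
  have "(1 - q) powi (int (lam 0) - int n) = 1 / (1 - q) ^ (n - lam 0)"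
    using partition_le_size[OF lam, of 0] q1
    by (simp add: power_int_diff power_diff)
  moreover have "q powi (int (n choose 2) - int (npart n lam)) = q ^ (n choose 2) / q ^ npart n lam"
    using q0 by (simp add: power_int_diff)
  moreover have "normalizer q (Suc n) n lam = q ^ npart n lam / q ^ (n choose 2) * (1 - q) ^ (n - lam 0) / ?P"
    by (simp add: normalizer_def npart_def lam_n power_one_over binomial_eq_0 field_simps)
  ultimately have "c * (?A * normalizer q (Suc n) n lam) =
    (q ^ (n choose 2) / q ^ npart n lam * (1 / (1 - q) ^ (n - lam 0)) * ?P / ?A)
     * (?A * (q ^ npart n lam / q ^ (n choose 2) * (1 - q) ^ (n - lam 0) / ?P))"
    by (simp only: c_def)
  moreover have "?A \<noteq> 0" "?P \<noteq> 0" "q \<noteq> 0" "1 - q \<noteq> 0" using A P q0 q1 by linarith+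
  \<comment> \<open>\<open>card_JF_flag\<close> expresses the count as the weight times the
    reciprocal of \<open>c\<close>; inverting needs 0 < q < 1.\<close>
  ultimately have c: "c * (?A * normalizer q (Suc n) n lam) = 1"
    by (simp del: prod_zero_iff)
  have part1: "wt q T = c * real (card (?M T))" if T: "is_ssyt lam \<alpha> T" for T
  proof -
    have "c * real (card (?M T)) = wt q T * (c * (?A * normalizer q (Suc n) n lam))"
      unfolding card_JF_flag[OF q lam T size] by (simp only: ac_simps)
    then show ?thesis unfolding c by simp
  qed
  \<comment> \<open>Each \<open>N\<close> has exactly one tableau, semistandard of shape
    \<open>JF n N\<close>, so the union is disjoint and part (ii) follows by summation.\<close>
  have "{N :: nat \<Rightarrow> nat \<Rightarrow> 'k. N \<in> nalpha n \<alpha> \<and> JF n N = lam} = (\<Union>T\<in>{T. is_ssyt lam \<alpha> T}. ?M T)"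
  proof (intro equalityI subsetI)
    fix N :: "nat \<Rightarrow> nat \<Rightarrow> 'k"
    assume "N \<in> {N. N \<in> nalpha n \<alpha> \<and> JF n N = lam}"
    then show "N \<in> (\<Union>T\<in>{T. is_ssyt lam \<alpha> T}. ?M T)" using ssyt_JF_flag[OF size, of N] by auto
  next
    fix N :: "nat \<Rightarrow> nat \<Rightarrow> 'k"
    assume "N \<in> (\<Union>T\<in>{T. is_ssyt lam \<alpha> T}. ?M T)"
    then have N: "N \<in> nalpha n \<alpha>" and T: "is_ssyt lam \<alpha> (JF_flag n \<alpha> N)" by auto
    have "JF n N = tshape (JF_flag n \<alpha> N) (length \<alpha>)"
      unfolding JF_eq_flag_JF[OF size N order_refl] by (rule ext) (rule tshape_JF_flag[OF size N, symmetric])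
    then show "N \<in> {N. N \<in> nalpha n \<alpha> \<and> JF n N = lam}" using N tshape_length[OF lam T size] by simp
  qed
  also have "card (\<Union>T\<in>{T. is_ssyt lam \<alpha> T}. ?M T) = (\<Sum>T\<in>{T. is_ssyt lam \<alpha> T}. card (?M T))"
    using finite_nalpha[OF size, where 'k = 'k]
    by (intro card_UN_disjoint finite_ssyt[OF lam size]) auto
  finally have "c * real (card {N :: nat \<Rightarrow> nat \<Rightarrow> 'k. N \<in> nalpha n \<alpha> \<and> JF n N = lam})
    = (\<Sum>T\<in>{T. is_ssyt lam \<alpha> T}. c * real (card (?M T)))"
    by (simp only: of_nat_sum sum_distrib_left)
  also have "\<dots> = W_coeff q lam \<alpha>" unfolding W_coeff_def using part1 by simp
  finally show ?thesis unfolding c_def[symmetric] using part1 by simp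
qed

end
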